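(* Let $K$ be a compact metrizable space and let $X$ be a subspace of $C(K)$ which is asymptotic $\ell_1$ with respect to a normalized Schauder basis $(e_n)$ of $X$. Suppose that $K$ is totally disconnected and let $\mathcal{M}$ be a $w^*$-compact subset of $B_{C(K)^{*}}$ which norms $X$. Then $\mathcal{M}$ is not separable in norm.
   Context: All Banach spaces are real; "subspace" means infinite-dimensional closed linear subspace. $C(K)$ has the supremum norm; $C(K)^*$ is identified with the finite signed regular Borel measures on $K$ with total variation norm and $B_{C(K)^*}$ is its closed unit ball. "Separable in norm" refers to the norm topology of $C(K)^*$. $\mathcal M$ norms $X$ if there is a constant $\rho>0$ such that for every $f\in X$ there is $\mu\in\mathcal M$ with $|\int_K f\,d\mu|\ge\rho\|f\|$. Block basis: $u_1<\dots<u_m$ is a block basis of $(e_n)$ if there are finite sets $F_1<\dots<F_m$ of positive integers ($\max F_i<\min F_{i+1}$) and non-zero scalars $\lambda_j$ with $u_i=\sum_{j\in F_i}\lambda_j e_j\neq0$; $\mathrm{supp}\,u_i=F_i$. $X$ is asymptotic $\ell_1$ with respect to its Schauder basis $(e_n)$ if there is $C>0$ such that $\|\sum_{i=1}^m u_i\|\ge C\sum_{i=1}^m\|u_i\|$ for every block basis $u_1<\dots<u_m$ of $(e_n)$ with $m\le\min\mathrm{supp}\,u_1$. *)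

theory Defs
  imports "HOL-Analysis.Analysis"
begin

definition totally_disconnected_space :: "'a topology \<Rightarrow> bool"
  where "totally_disconnected_space T \<longleftrightarrow> (\<forall>S. connectedin T S \<longrightarrow> (\<exists>x. S \<subseteq> {x}))"

definition banach_subspace :: "'v::real_normed_vector set \<Rightarrow> bool"
  where "banach_subspace X \<longleftrightarrow>
    subspace X \<and> closed X \<and> \<not> (\<exists>B. finite B \<and> span B = X)"

text \<open>
  The compact space \<open>K\<close> is the universe of a type \<open>'k\<close>, so \<open>C(K)\<close> is the type of bounded
  continuous functions on \<open>'k\<close> with the supremum norm. Its dual is the type of bounded linear
  functionals with the operator norm. Under the Riesz identification with the finite signed
  regular Borel measures, the operator norm is the total variation norm, and the functional
  \<open>\<mu>\<close> evaluated at \<open>f\<close> is the integral of \<open>f\<close> with respect to the measure \<open>\<mu>\<close>.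
\<close>

type_synonym 'k C = "'k \<Rightarrow>\<^sub>C real"
type_synonym 'k C_dual = "'k C \<Rightarrow>\<^sub>L real"

text \<open>For real-valued operators, pointwise convergence is weak-star convergence.\<close>

abbreviation weak_star_topology :: "('v::real_normed_vector \<Rightarrow>\<^sub>L real) topology"
  where "weak_star_topology \<equiv> strong_operator_topology"

definition norms :: "'k::topological_space C_dual set \<Rightarrow> 'k C set \<Rightarrow> bool"
  where "norms M X \<longleftrightarrow>
    (\<exists>\<rho>>0. \<forall>f\<in>X. \<exists>\<mu>\<in>M. \<bar>blinfun_apply \<mu> f\<bar> \<ge> \<rho> * norm f)"

text \<open>
  Bases are indexed by the positive integers: the value \<open>e 0\<close> is never used. The
  requirement \<open>a 0 = 0\<close> only makes the coefficient sequence unique as a function on all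
  natural numbers.
\<close>

definition schauder_basis :: "(nat \<Rightarrow> 'v::real_normed_vector) \<Rightarrow> 'v set \<Rightarrow> bool"
  where "schauder_basis e X \<longleftrightarrow>
    (\<forall>n\<ge>1. e n \<in> X) \<and>
    (\<forall>x\<in>X. \<exists>!a :: nat \<Rightarrow> real. a 0 = 0 \<and> (\<lambda>n. a n *\<^sub>R e n) sums x)"

definition normalized :: "(nat \<Rightarrow> 'v::real_normed_vector) \<Rightarrow> bool"
  where "normalized e \<longleftrightarrow> (\<forall>n\<ge>1. norm (e n) = 1)"

text \<open>\<open>u 1 < \<dots> < u m\<close> is a block basis of \<open>e\<close> with supports \<open>F 1 < \<dots> < F m\<close>.\<close>

definition block_basis ::
    "(nat \<Rightarrow> 'v::real_normed_vector) \<Rightarrow> nat \<Rightarrow> (nat \<Rightarrow> 'v) \<Rightarrow> (nat \<Rightarrow> nat set) \<Rightarrow> bool"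
  where "block_basis e m u F \<longleftrightarrow>
    (\<forall>i\<in>{1..m}. finite (F i) \<and> F i \<noteq> {} \<and> F i \<subseteq> {1..}) \<and>
    (\<forall>i\<in>{1..<m}. Max (F i) < Min (F (Suc i))) \<and>
    (\<exists>c :: nat \<Rightarrow> real. \<forall>i\<in>{1..m}.
      (\<forall>j\<in>F i. c j \<noteq> 0) \<and> u i = (\<Sum>j\<in>F i. c j *\<^sub>R e j) \<and> u i \<noteq> 0)"

definition asymptotic_l1 :: "(nat \<Rightarrow> 'v::real_normed_vector) \<Rightarrow> bool"
  where "asymptotic_l1 e \<longleftrightarrow>
    (\<exists>C>0. \<forall>m\<ge>1. \<forall>u F. block_basis e m u F \<and> m \<le> Min (F 1) \<longrightarrow>
      norm (\<Sum>i=1..m. u i) \<ge> C * (\<Sum>i=1..m. norm (u i)))"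

end

theory Submission
  imports Defs "HOL-Real_Asymp.Real_Asymp"
begin

text \<open>
  Suppose that \<open>M\<close> is separable in norm, with dense sequence \<open>d k\<close>. On finitely many functionals the
  signed sums of \<open>n\<close> basis vectors can be made of order \<open>sqrt n\<close> in mean square, while their norm is
  at least \<open>C n\<close>. This gives normalized blocks \<open>y j\<close> of the basis that exceed a tiny threshold
  \<open>t j\<close> only on a clopen set carrying little mass of \<open>d 0, \<dots>, d j\<close>. By density, each \<open>\<mu>\<close>
  in \<open>M\<close> charges only finitely many of these sets by more than \<open>\<epsilon>\<close>. As \<open>M\<close> is
  weak-star compact and mass on a fixed clopen partition is weak-star continuous, the finite sets
  of indices that are charged simultaneously by some \<open>\<mu>\<close> form a hereditary family without infinite
  branch.

  For such a family one finds, by well-founded induction, coefficients \<open>a\<close> and a probability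
  vector \<open>p\<close> such that \<open>p\<close> is small on the family and, for the norm \<open>\<parallel>\<Sum> a i |y i|\<parallel>\<close>, the
  restriction of \<open>a\<close> to an index set \<open>H\<close> has norm at most \<open>p(H)\<close> to the power \<open>g\<close>, while
  \<open>a\<close> itself has norm \<open>1\<close>. After a choice of signs this is a vector of norm \<open>1\<close> in \<open>X\<close>
  on which all elements of \<open>M\<close> are uniformly small, so \<open>M\<close> does not norm \<open>X\<close>.
\<close>

subsection \<open>Regular averages\<close>

text \<open>The power with exponent \<open>g\<close> is concave, and the right-hand side is its
  tangent at \<open>m\<close>; this is Young's inequality for \<open>x / m\<close> and 1.\<close>

lemma powr_le_tangent:
  fixes x m g :: real
  assumes "0 \<le> x" "0 < m" "0 \<le> g" "g \<le> 1"
  shows "x powr g \<le> m powr g * (g * (x / m) + (1 - g))"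
proof (cases "x = 0")
  case True
  then show ?thesis using assms by simp
next
  case False
  then have "(x / m) powr g * 1 powr (1 - g) \<le> g * (x / m) + (1 - g) * 1"
    using assms by (intro Youngs_inequality_0) auto
  then have "m powr g * (x / m) powr g \<le> m powr g * (g * (x / m) + (1 - g))"
    by (intro mult_left_mono) auto
  moreover have "m powr g * (x / m) powr g = x powr g"
    using assms by (simp add: powr_mult [symmetric])
  ultimately show ?thesis by simp
qed

text \<open>Jensen's inequality for a concave power: each power is replaced by the tangent at the
  weighted sum \<open>m\<close>. Total weight below 1 does no harm, since it only multiplies the
  nonnegative constant term \<open>1 - g\<close>.\<close>

lemma sum_mult_powr_le:
  fixes w x :: "'i \<Rightarrow> real"
  assumes "finite A" and w: "\<And>i. i \<in> A \<Longrightarrow> 0 \<le> w i" and x: "\<And>i. i \<in> A \<Longrightarrow> 0 \<le> x i"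
    and w1: "sum w A \<le> 1" and g: "0 < g" "g \<le> 1"
  shows "(\<Sum>i\<in>A. w i * x i powr g) \<le> (\<Sum>i\<in>A. w i * x i) powr g"
proof -
  define m where "m = (\<Sum>i\<in>A. w i * x i)"
  have m0: "0 \<le> m" unfolding m_def using w x by (intro sum_nonneg) auto
  show ?thesis
  proof (cases "m = 0")
    case True
    then have "\<And>i. i \<in> A \<Longrightarrow> w i * x i = 0"
      using sum_nonneg_eq_0_iff [OF \<open>finite A\<close>, of "\<lambda>i. w i * x i"] w x
      by (auto simp: m_def)
    then have "(\<Sum>i\<in>A. w i * x i powr g) = 0"
      by (intro sum.neutral) auto
    then show ?thesis by simp
  next
    case False
    with m0 have m: "0 < m" by simp
    have "(\<Sum>i\<in>A. w i * x i powr g) \<le> (\<Sum>i\<in>A. w i * (m powr g * (g * (x i / m) + (1 - g))))"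
      using w x m g by (intro sum_mono mult_left_mono powr_le_tangent) auto
    also have "\<dots> = m powr g * (g * ((\<Sum>i\<in>A. w i * x i) / m) + (1 - g) * sum w A)"
      by (simp add: sum_distrib_left sum.distrib [symmetric] sum_divide_distrib)
        (intro sum.cong refl, simp add: field_simps)
    also have "\<dots> = m powr g * (g + (1 - g) * sum w A)"
      using m by (simp add: m_def [symmetric])
    also have "\<dots> \<le> m powr g * 1"
      using w1 g mult_left_mono[of "sum w A" 1 "1-g"] by (intro mult_left_mono) auto
    finally show ?thesis by (simp add: m_def)
  qed
qed

text \<open>For functions \<open>y i\<close> and \<open>a \<ge> 0\<close>, \<open>sign_norm y I a\<close> is the supremum norm of \<open>\<Sum>i\<in>I. a i * |y i|\<close>.\<close>

definition sign_sum :: "(nat \<Rightarrow> 'v::real_normed_vector) \<Rightarrow> nat set \<Rightarrow> (nat \<Rightarrow> real) \<Rightarrow> nat set \<Rightarrow> 'v"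
  where "sign_sum y I a S = (\<Sum>i\<in>I. (if i \<in> S then a i else - a i) *\<^sub>R y i)"

definition sign_norm :: "(nat \<Rightarrow> 'v::real_normed_vector) \<Rightarrow> nat set \<Rightarrow> (nat \<Rightarrow> real) \<Rightarrow> real"
  where "sign_norm y I a = Max ((\<lambda>S. norm (sign_sum y I a S)) ` Pow I)"

lemma sign_sum_Int: "sign_sum y I a (S \<inter> I) = sign_sum y I a S"
  unfolding sign_sum_def by (intro sum.cong) auto

lemma norm_sign_sum_le: "finite I \<Longrightarrow> norm (sign_sum y I a S) \<le> sign_norm y I a"
  unfolding sign_norm_def
  by (subst sign_sum_Int [symmetric], intro Max_ge) auto

lemma sign_norm_attained:
  assumes "finite I"
  obtains S where "norm (sign_sum y I a S) = sign_norm y I a"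
proof -
  have "sign_norm y I a \<in> (\<lambda>S. norm (sign_sum y I a S)) ` Pow I"
    unfolding sign_norm_def using assms by (intro Max_in) auto
  then show ?thesis using that by auto
qed

lemma sign_norm_cong:
  assumes "\<And>i. i \<in> I \<Longrightarrow> a i = b i"
  shows "sign_norm y I a = sign_norm y I b"
proof -
  have "sign_sum y I a S = sign_sum y I b S" for S
    unfolding sign_sum_def using assms by (intro sum.cong) auto
  then show ?thesis unfolding sign_norm_def by presburger
qed

lemma sign_norm_scale:
  assumes "finite I" "0 \<le> c"
  shows "sign_norm y I (\<lambda>i. c * a i) = c * sign_norm y I a"
proof -
  have eq: "sign_sum y I (\<lambda>i. c * a i) S = c *\<^sub>R sign_sum y I a S" for S
    unfolding sign_sum_def scaleR_sum_right by (intro sum.cong) auto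
  obtain S where S: "norm (sign_sum y I a S) = sign_norm y I a"
    using sign_norm_attained assms(1) by metis
  obtain T where T: "norm (sign_sum y I (\<lambda>i. c * a i) T) = sign_norm y I (\<lambda>i. c * a i)"
    using sign_norm_attained assms(1) by metis
  have "norm (sign_sum y I (\<lambda>i. c * a i) T) \<le> c * sign_norm y I a"
    using norm_sign_sum_le[OF assms(1), of y a T] assms(2)
    by (simp add: eq mult_left_mono)
  moreover have "c * norm (sign_sum y I a S) \<le> sign_norm y I (\<lambda>i. c * a i)"
    using norm_sign_sum_le[OF assms(1), of y "\<lambda>i. c * a i" S] assms(2) by (simp add: eq)
  ultimately show ?thesis using S T by simp
qed

lemma sign_norm_empty [simp]: "sign_norm y {} a = 0"
  by (simp add: sign_norm_def sign_sum_def)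

lemma sign_norm_singleton [simp]: "sign_norm y {i} a = \<bar>a i\<bar> * norm (y i)"
proof -
  have "(\<lambda>S. norm (sign_sum y {i} a S)) ` Pow {i} = {\<bar>a i\<bar> * norm (y i)}"
    by (auto simp: sign_sum_def Pow_insert)
  then show ?thesis by (simp add: sign_norm_def)
qed

lemma sign_norm_UN_le:
  assumes "finite J" "\<And>j. j \<in> J \<Longrightarrow> finite (I j)" "disjoint_family_on I J"
  shows "sign_norm y (\<Union>j\<in>J. I j) a \<le> (\<Sum>j\<in>J. sign_norm y (I j) a)"
proof -
  have fin: "finite (\<Union>j\<in>J. I j)" using assms by auto
  then obtain S where S: "norm (sign_sum y (\<Union>j\<in>J. I j) a S) = sign_norm y (\<Union>j\<in>J. I j) a"
    using sign_norm_attained by metis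
  have "sign_sum y (\<Union>j\<in>J. I j) a S = (\<Sum>j\<in>J. sign_sum y (I j) a S)"
    unfolding sign_sum_def using assms
    by (intro sum.UNION_disjoint) (auto simp: disjoint_family_on_def)
  then have "norm (sign_sum y (\<Union>j\<in>J. I j) a S) \<le> (\<Sum>j\<in>J. norm (sign_sum y (I j) a S))"
    by (simp add: norm_sum)
  also have "\<dots> \<le> (\<Sum>j\<in>J. sign_norm y (I j) a)"
    using assms by (intro sum_mono norm_sign_sum_le) auto
  finally show ?thesis using S by simp
qed

section \<open>Induction along a hereditary family of finite sets\<close>

text \<open>This is the asymptotic l1 estimate in terms of sign norms. The condition
  \<open>N \<le> i\<close> reflects the admissibility condition on the first support; strict
  positivity makes coefficients and blocks non-zero.\<close>

definition lower_l1 :: "real \<Rightarrow> (nat \<Rightarrow> 'v::real_normed_vector) \<Rightarrow> bool"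
  where "lower_l1 C y \<longleftrightarrow> (\<forall>N I a.
    (\<forall>j<N. finite (I j) \<and> (\<forall>i\<in>I j. N \<le> i \<and> 0 < a i) \<and> 0 < sign_norm y (I j) a) \<and>
    (\<forall>j k. j < k \<and> k < N \<longrightarrow> (\<forall>i\<in>I j. \<forall>l\<in>I k. i < l)) \<longrightarrow>
    C * (\<Sum>j<N. sign_norm y (I j) a) \<le> sign_norm y (\<Union>j<N. I j) a)"

text \<open>Asking for the bound on every subset, not on \<open>I\<close> alone, is what allows
  averages of averages to be estimated by Jensen's inequality and bad parts of \<open>I\<close> to
  be discarded later.\<close>

definition regular_average ::
    "(nat \<Rightarrow> 'v::real_normed_vector) \<Rightarrow> real \<Rightarrow> nat set \<Rightarrow> (nat \<Rightarrow> real) \<Rightarrow> (nat \<Rightarrow> real) \<Rightarrow> bool"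
  where "regular_average y g I a p \<longleftrightarrow>
    finite I \<and> (\<forall>i\<in>I. 0 < a i \<and> 0 \<le> p i) \<and> sum p I = 1 \<and> sign_norm y I a = 1 \<and>
    (\<forall>H\<subseteq>I. sign_norm y H a \<le> sum p H powr g)"

text \<open>The set \<open>F\<close> stands for nodes of the tree \<open>\<G>\<close>: \<open>p\<close> has to be small on the branches through
  each of them. Admitting every exponent below \<open>1\<close> lets each step of the induction lose exponent.\<close>

definition small_averages ::
    "(nat \<Rightarrow> 'v::real_normed_vector) \<Rightarrow> nat set set \<Rightarrow> nat set set \<Rightarrow> bool"
  where "small_averages y \<G> F \<longleftrightarrow> (\<forall>g \<delta> n. 0 < g \<and> g < 1 \<and> 0 < \<delta> \<longrightarrow>
    (\<exists>I a p. regular_average y g I a p \<and> I \<subseteq> {n<..} \<and>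
      (\<forall>s\<in>F. \<forall>H\<subseteq>I. s \<union> H \<in> \<G> \<longrightarrow> sum p H \<le> \<delta>)))"

text \<open>Base of the induction: when no smallness is demanded, a single index beyond
  \<open>n\<close> with weight 1 will do.\<close>

lemma small_averages_empty:
  assumes "\<And>n. norm (y n) = 1"
  shows "small_averages y \<G> {}"
  unfolding small_averages_def
proof (intro allI impI)
  fix g \<delta> :: real and n :: nat
  assume g: "0 < g \<and> g < 1 \<and> 0 < \<delta>"
  have "sign_norm y H (\<lambda>_. 1) \<le> (\<Sum>i\<in>H. 1) powr g" if "H \<subseteq> {Suc n}" for H
    using that g by (auto simp: subset_singleton_iff assms)
  then have "regular_average y g {Suc n} (\<lambda>_. 1) (\<lambda>_. 1)"
    by (auto simp: regular_average_def assms)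
  then show "\<exists>I a p. regular_average y g I a p \<and> I \<subseteq> {n<..} \<and>
      (\<forall>s\<in>{}. \<forall>H\<subseteq>I. s \<union> H \<in> \<G> \<longrightarrow> sum p H \<le> \<delta>)"
    by (intro exI conjI) auto
qed

text \<open>Restricting to a maximizer of \<open>sign_norm y H a / sum p H powr g\<close> makes the average regular
  again, at the cost of any decrease of the exponent; the price is only a bounded increase of \<open>p\<close>.\<close>

lemma regular_restriction:
  assumes fin: "finite I" and pos: "\<And>i. i \<in> I \<Longrightarrow> 0 < a i \<and> 0 \<le> p i"
    and p1: "sum p I = 1" and C: "0 < C" "C \<le> sign_norm y I a"
    and le: "\<And>H. H \<subseteq> I \<Longrightarrow> sign_norm y H a \<le> sum p H powr g"
    and g: "0 < g'" "g' < g"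
  obtains H c where "H \<subseteq> I" "C powr (1 / (g - g')) \<le> sum p H" "c > 0"
    "regular_average y g' H (\<lambda>i. c * a i) (\<lambda>i. p i / sum p H)"
proof -
  \<comment> \<open>Only sets of positive mass compete, so that the ratio \<open>r\<close> has a
    non-zero denominator.\<close>
  define \<H> where "\<H> = {H. H \<subseteq> I \<and> 0 < sum p H}"
  define r where "r H = sign_norm y H a / sum p H powr g'" for H
  have "finite \<H>" unfolding \<H>_def using fin by simp
  moreover have I: "I \<in> \<H>" using p1 by (simp add: \<H>_def)
  ultimately have "Max (r ` \<H>) \<in> r ` \<H>"
    by (intro Max_in) auto
  moreover have "\<And>K. K \<in> \<H> \<Longrightarrow> r K \<le> Max (r ` \<H>)"
    using \<open>finite \<H>\<close> by simp
  ultimately obtain H where H: "H \<in> \<H>" and max: "\<And>K. K \<in> \<H> \<Longrightarrow> r K \<le> r H"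
    by auto
  define h where "h = sum p H"
  have h: "0 < h" "H \<subseteq> I" using H by (auto simp: \<H>_def h_def)
  have "finite H" using h fin finite_subset by auto
  \<comment> \<open>At \<open>I\<close> the mass is 1, so the ratio is at least \<open>C\<close>.
    Comparing the maximal ratio with the upper bound for the larger exponent \<open>g\<close> forces
    \<open>H\<close> to keep a fixed share of the mass.\<close>
  have "C \<le> r I" using C p1 by (simp add: r_def)
  then have "C \<le> r H" using max I by force
  then have CH: "C * h powr g' \<le> sign_norm y H a"
    using h by (simp add: r_def h_def field_simps)
  also have "\<dots> \<le> h powr g" using le h by (simp add: h_def)
  finally have "C \<le> h powr g / h powr g'" using h by (simp add: field_simps)
  then have "C \<le> h powr (g - g')" by (simp add: powr_diff)
  then have "C powr (1 / (g - g')) \<le> (h powr (g - g')) powr (1 / (g - g'))"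
    using C g by (intro powr_mono2) auto
  then have hC: "C powr (1 / (g - g')) \<le> h" using g h by (simp add: powr_powr)
  define N where "N = sign_norm y H a"
  have N: "0 < N" using CH C h unfolding N_def by (smt (verit) mult_pos_pos powr_gt_zero)
  \<comment> \<open>Maximality of \<open>r H\<close> is regularity with exponent \<open>g'\<close>
    after normalization. Sets of mass 0 were not compared, but \<open>le\<close> gives them norm
    0.\<close>
  have reg: "sign_norm y K (\<lambda>i. (1/N) * a i) \<le> (\<Sum>i\<in>K. p i / h) powr g'" if "K \<subseteq> H" for K
  proof -
    have finK: "finite K" using that \<open>finite H\<close> finite_subset by auto
    have *: "sign_norm y K (\<lambda>i. (1/N) * a i) = sign_norm y K a / N"
      using sign_norm_scale[OF finK, of "1/N" y a] N by simp
    have **: "(\<Sum>i\<in>K. p i / h) = sum p K / h" by (simp add: sum_divide_distrib)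
    have "0 \<le> sum p K" using pos that h by (intro sum_nonneg) auto
    then consider "sum p K = 0" | "0 < sum p K" by fastforce
    then show ?thesis
    proof cases
      case 1
      then have "sign_norm y K a \<le> 0" using le[of K] that h by auto
      then show ?thesis using 1 N unfolding * ** by (simp add: divide_le_0_iff)
    next
      case 2
      then have "r K \<le> r H" using max that h by (auto simp: \<H>_def)
      then have "sign_norm y K a / N \<le> sum p K powr g' / h powr g'"
        using 2 N h by (simp add: r_def N_def h_def field_simps)
      then show ?thesis using 2 h unfolding * ** by (simp add: powr_divide)
    qed
  qed
  have "sign_norm y H (\<lambda>i. (1/N) * a i) = 1"
    using sign_norm_scale[OF \<open>finite H\<close>, of "1/N" y a] N by (simp add: N_def)
  moreover have "(\<Sum>i\<in>H. p i / h) = 1"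
    using h by (simp add: sum_divide_distrib[symmetric] h_def)
  ultimately have "regular_average y g' H (\<lambda>i. (1/N) * a i) (\<lambda>i. p i / sum p H)"
    unfolding regular_average_def using \<open>finite H\<close> pos h N reg
    by (auto simp: h_def)
  then show ?thesis using that[of H "1/N"] h N hC by (simp add: h_def)
qed

text \<open>Take the mean of \<open>N\<close> successive averages, each small on \<open>F\<close>
  and on those children of \<open>s\<close> whose new element is at most the largest index of the
  preceding average. A set \<open>H\<close> with \<open>s \<union> H\<close> in \<G> then has full
  weight in at most one of them, namely the one containing its least element. The lower l1 estimate
  keeps the norm of the mean above \<open>C\<close>, and \<open>regular_restriction\<close> restores
  regularity.\<close>

lemma small_averages_insert:
  assumes low: "lower_l1 C y" "0 < C"
    and hered: "\<And>A B. A \<in> \<G> \<Longrightarrow> B \<subseteq> A \<Longrightarrow> B \<in> \<G>"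
    and "finite s"
    and children: "\<And>m. small_averages y \<G>
      (F \<union> {insert i s | i. i \<le> m \<and> (\<forall>x\<in>s. x < i) \<and> insert i s \<in> \<G>})"
  shows "small_averages y \<G> (insert s F)"
  unfolding small_averages_def
proof (intro allI impI)
  fix g' \<delta> :: real and n0 :: nat
  assume A: "0 < g' \<and> g' < 1 \<and> 0 < \<delta>"
  \<comment> \<open>An exponent strictly between \<open>g'\<close> and 1; the gap
    \<open>g - g'\<close> is spent when regularity is restored.\<close>
  define g where "g = (1 + g') / 2"
  have g: "0 < g" "g < 1" "g' < g" using A by (auto simp: g_def)
  define h where "h = C powr (1 / (g - g'))"
  have h: "0 < h" using low by (simp add: h_def)
  \<comment> \<open>Restriction will divide \<open>p\<close> by a mass of at least \<open>h\<close>,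
    so the target before it is \<open>\<delta> * h\<close>: one half for the exceptional average of
    weight \<open>1 / N\<close>, one half for all the others.\<close>
  define \<delta>' where "\<delta>' = \<delta> * h / 2"
  have \<delta>': "0 < \<delta>'" using A h by (simp add: \<delta>'_def)
  obtain N :: nat where N: "1 / \<delta>' < real N" using reals_Archimedean2 by blast
  have N0: "0 < N" using N \<delta>' by (cases N) (auto simp: field_simps)
  have N1: "1 / N \<le> \<delta>'" using N N0 \<delta>' by (simp add: field_simps)
  \<comment> \<open>Beyond \<open>n0\<close> as the conclusion demands, beyond \<open>N\<close> for
    the lower l1 estimate, and beyond \<open>s\<close> so that every later index extends
    \<open>s\<close> at its end.\<close>
  define n1 where "n1 = n0 + N + Max (insert 0 s)"
  have n1: "n0 \<le> n1" "N \<le> n1" "\<And>x. x \<in> s \<Longrightarrow> x \<le> n1"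
    using \<open>finite s\<close> by (auto simp: n1_def trans_le_add2)
  define A where "A m = {insert i s | i. i \<le> m \<and> (\<forall>x\<in>s. x < i) \<and> insert i s \<in> \<G>}" for m
  define small where "small p I T \<longleftrightarrow> (\<forall>t\<in>T. \<forall>H\<subseteq>I. t \<union> H \<in> \<G> \<longrightarrow> sum p H \<le> \<delta>')"
    for p :: "nat \<Rightarrow> real" and I T
  have small_mono: "small p I T" "small p I T'" if "small p I (T \<union> T')" for p I T T'
    using that unfolding small_def by (meson UnI1, meson UnI2)
  have ex: "\<exists>I a p. regular_average y g I a p \<and> I \<subseteq> {n<..} \<and> small p I (F \<union> A m)" for n m
    using children[of m, folded A_def, unfolded small_averages_def, rule_format, of g \<delta>' n] g \<delta>'
    unfolding small_def by blast
  define P where "P = (\<lambda>(k::nat) (I, a, p). regular_average y g I a p \<and> I \<subseteq> {n1<..} \<and> small p I F)"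
  define Q where "Q = (\<lambda>(k::nat) (I :: nat set, a :: nat \<Rightarrow> real, p :: nat \<Rightarrow> real) (I', a' :: nat \<Rightarrow> real, p').
    I' \<subseteq> {Max I<..} \<and> small p' I' (A (Max I)))"
  have "\<exists>f. \<forall>k. P k (f k) \<and> Q k (f k) (f (Suc k))"
  proof (rule dependent_nat_choice)
    obtain I a p where "regular_average y g I a p" "I \<subseteq> {n1<..}" "small p I (F \<union> A 0)"
      using ex[of n1 0] by (elim exE conjE)
    then have "P 0 (I, a, p)" using small_mono(1)[of p I F "A 0"] by (simp add: P_def)
    then show "\<exists>x. P 0 x" by blast
  next
    fix x k assume "P k x"
    obtain I a p where x: "x = (I, a, p)" by (rule prod_cases3)
    obtain I' a' p' where "regular_average y g I' a' p'" "I' \<subseteq> {max n1 (Max I)<..}"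
        "small p' I' (F \<union> A (Max I))"
      using ex[of "max n1 (Max I)" "Max I"] by (elim exE conjE)
    then have "P (Suc k) (I', a', p') \<and> Q k x (I', a', p')"
      using small_mono[of p' I' F "A (Max I)"] unfolding P_def Q_def x by (simp add: subset_eq)
    then show "\<exists>y. P (Suc k) y \<and> Q k x y" by blast
  qed
  then obtain f where f: "\<And>k. P k (f k)" "\<And>k. Q k (f k) (f (Suc k))" by blast
  define I where "I k = fst (f k)" for k
  define ak where "ak k = fst (snd (f k))" for k
  define pk where "pk k = snd (snd (f k))" for k
  have f_eq: "f k = (I k, ak k, pk k)" for k by (simp add: I_def ak_def pk_def)
  have reg: "regular_average y g (I k) (ak k) (pk k)" and I_n1: "I k \<subseteq> {n1<..}"
    and smallF: "small (pk k) (I k) F" for k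
    using f(1)[of k] by (auto simp: f_eq P_def)
  have I_Max: "I (Suc k) \<subseteq> {Max (I k)<..}" and smallA: "small (pk (Suc k)) (I (Suc k)) (A (Max (I k)))" for k
    using f(2)[of k] by (auto simp: f_eq Q_def)
  have finI: "finite (I k)" and posI: "\<And>i. i \<in> I k \<Longrightarrow> 0 < ak k i \<and> 0 \<le> pk k i"
    and sum1: "sum (pk k) (I k) = 1" and norm1: "sign_norm y (I k) (ak k) = 1"
    and regI: "\<And>H. H \<subseteq> I k \<Longrightarrow> sign_norm y H (ak k) \<le> sum (pk k) H powr g" for k
    using reg[of k] by (auto simp: regular_average_def)
  have I_ne: "I k \<noteq> {}" for k using sum1[of k] by auto
  have "Max (I k) < Max (I (Suc k))" for k
    using I_Max[of k] Max_in[OF finI I_ne, of "Suc k"] by auto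
  then have mono: "Max (I j) \<le> Max (I k)" if "j \<le> k" for j k
    using lift_Suc_mono_le[of "\<lambda>k. Max (I k)", OF less_imp_le that] by blast
  have ord: "i < l" if "j < k" "i \<in> I j" "l \<in> I k" for i j k l
  proof -
    obtain k' where k': "k = Suc k'" "j \<le> k'" using \<open>j < k\<close> by (cases k) auto
    have "i \<le> Max (I j)" using that finI by simp
    also have "\<dots> \<le> Max (I k')" using mono k' by simp
    also have "\<dots> < l" using I_Max[of k'] that k' by auto
    finally show ?thesis .
  qed
  have disj: "disjoint_family_on I J" for J
    unfolding disjoint_family_on_def by (metis disjoint_iff less_irrefl nat_neq_iff ord)
  define U where "U = (\<Union>k<N. I k)"
  have finU: "finite U" using finI by (simp add: U_def)
  define a where "a i = (\<Sum>k<N. if i \<in> I k then ak k i / N else 0)" for i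
  define p where "p i = (\<Sum>k<N. if i \<in> I k then pk k i / N else 0)" for i
  have only: "i \<in> I j \<longleftrightarrow> j = k" if "i \<in> I k" for i j k
    using that ord by (metis less_irrefl nat_neq_iff)
  have a_eq: "a i = (1 / N) * ak k i" if "i \<in> I k" "k < N" for i k
    using that by (simp add: a_def only[OF that(1)])
  have p_nn: "0 \<le> p i" for i unfolding p_def using posI by (intro sum_nonneg) auto
  have p_sum: "sum p H = (\<Sum>k<N. (1 / N) * sum (pk k) (H \<inter> I k))" if "finite H" for H
  proof -
    have "sum p H = (\<Sum>k<N. \<Sum>i\<in>H. if i \<in> I k then pk k i / N else 0)"
      unfolding p_def by (rule sum.swap)
    also have "\<dots> = (\<Sum>k<N. \<Sum>i\<in>H \<inter> I k. pk k i / N)"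
      using that by (simp add: sum.inter_restrict)
    finally show ?thesis by (simp add: sum_divide_distrib)
  qed
  have a_norm: "sign_norm y H a = (1 / N) * sign_norm y H (ak k)" if "H \<subseteq> I k" "k < N" for H k
  proof -
    have "sign_norm y H a = sign_norm y H (\<lambda>i. (1 / N) * ak k i)"
      using that a_eq by (intro sign_norm_cong) auto
    then show ?thesis
      using sign_norm_scale[OF finite_subset[OF that(1) finI], of "1/N" y "ak k"] by simp
  qed
  have U_sum: "sum p U = 1"
  proof -
    have "U \<inter> I k = I k" if "k < N" for k using that by (auto simp: U_def)
    then show ?thesis using p_sum[OF finU] sum1 N0 by simp
  qed
  have U_pos: "0 < a i \<and> 0 \<le> p i" if "i \<in> U" for i
    using that p_nn a_eq posI N0 by (force simp: U_def)
  \<comment> \<open>Triangle inequality over the groups, regularity of each group, then Jensen with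
    weights \<open>1 / N\<close>.\<close>
  have U_le: "sign_norm y H a \<le> sum p H powr g" if "H \<subseteq> U" for H
  proof -
    have finH: "finite H" using that finU finite_subset by auto
    have "disjoint_family_on (\<lambda>k. H \<inter> I k) {..<N}"
      using disj[of "{..<N}"] by (rule disjoint_family_on_bisimulation) auto
    then have "sign_norm y (\<Union>k<N. H \<inter> I k) a \<le> (\<Sum>k<N. sign_norm y (H \<inter> I k) a)"
      using finI by (intro sign_norm_UN_le) auto
    moreover have "(\<Union>k<N. H \<inter> I k) = H" using that by (auto simp: U_def)
    ultimately have "sign_norm y H a \<le> (\<Sum>k<N. sign_norm y (H \<inter> I k) a)" by simp
    also have "\<dots> \<le> (\<Sum>k<N. (1 / N) * sum (pk k) (H \<inter> I k) powr g)"
    proof (rule sum_mono)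
      fix k assume "k \<in> {..<N}"
      then have "sign_norm y (H \<inter> I k) a = (1 / N) * sign_norm y (H \<inter> I k) (ak k)"
        by (intro a_norm) auto
      also have "\<dots> \<le> (1 / N) * sum (pk k) (H \<inter> I k) powr g"
        by (intro mult_left_mono regI) auto
      finally show "sign_norm y (H \<inter> I k) a \<le> (1 / N) * sum (pk k) (H \<inter> I k) powr g" .
    qed
    also have "\<dots> \<le> (\<Sum>k<N. (1 / N) * sum (pk k) (H \<inter> I k)) powr g"
      using g N0 posI by (intro sum_mult_powr_le) (auto intro!: sum_nonneg)
    finally show ?thesis using p_sum[OF finH] by simp
  qed
  \<comment> \<open>The \<open>N\<close> groups have norm \<open>1 / N\<close> each and lie beyond
    \<open>N\<close>, so the lower estimate applies to them.\<close>
  have U_low: "C \<le> sign_norm y U a"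
  proof -
    have norm_a: "sign_norm y (I k) a = 1 / N" if "k < N" for k
      using a_norm[of "I k" k] norm1[of k] that by simp
    have "finite (I k) \<and> (\<forall>i\<in>I k. N \<le> i \<and> 0 < a i) \<and> 0 < sign_norm y (I k) a" if "k < N" for k
    proof (intro conjI ballI)
      fix i assume i: "i \<in> I k"
      show "N \<le> i" using I_n1[of k] n1(2) i by auto
      show "0 < a i" using U_pos[of i] i that by (auto simp: U_def)
    qed (use finI norm_a that N0 in auto)
    then have "C * (\<Sum>k<N. sign_norm y (I k) a) \<le> sign_norm y U a"
      using low(1)[unfolded lower_l1_def, rule_format, of N I a] ord unfolding U_def by blast
    moreover have "(\<Sum>k<N. sign_norm y (I k) a) = 1"
      using N0 by (simp add: norm_a)
    ultimately show ?thesis by simp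
  qed
  obtain H0 c where H0: "H0 \<subseteq> U" "h \<le> sum p H0" "c > 0"
      "regular_average y g' H0 (\<lambda>i. c * a i) (\<lambda>i. p i / sum p H0)"
    using regular_restriction[OF finU U_pos U_sum low(2) U_low U_le _ g(3)] A unfolding h_def by blast
  have small_p: "sum p H \<le> \<delta> * h" if "t \<in> insert s F" "H \<subseteq> H0" "t \<union> H \<in> \<G>" for t H
  proof -
    have HU: "H \<subseteq> U" using that(2) H0(1) by blast
    note H = finite_subset[OF HU finU] HU
    have sub: "t \<union> (H \<inter> I k) \<in> \<G>" for k
      by (rule hered[OF that(3)]) auto
    show ?thesis
    proof (cases "t \<in> F")
      case True
      then have "sum (pk k) (H \<inter> I k) \<le> \<delta>'" for k
        using smallF[of k, unfolded small_def, rule_format, of t "H \<inter> I k"] sub[of k] by simp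
      then have "sum p H \<le> (\<Sum>k<N. (1 / N) * \<delta>')"
        unfolding p_sum[OF H(1)] by (intro sum_mono mult_left_mono) auto
      also have "\<dots> = \<delta>'" using N0 by simp
      finally show ?thesis using \<delta>' by (simp add: \<delta>'_def)
    next
      case False
      then have ts: "t = s" using that by simp
      show ?thesis
      proof (cases "H = {}")
        case True then show ?thesis using A h by simp
      next
        case False
        \<comment> \<open>Groups before that of \<open>i\<close> miss \<open>H\<close>, and the
          group of \<open>i\<close> has mass 1 at most. Every later group was chosen when
          \<open>insert i s\<close> was already among the children to be respected, so
          \<open>H\<close> has mass at most \<open>\<delta>'\<close> there.\<close>
        define i where "i = Min H"
        have i: "i \<in> H" using False H by (simp add: i_def)
        then obtain j where j: "j < N" "i \<in> I j" using H by (auto simp: U_def)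
        have ins: "insert i s \<in> \<G>"
          by (rule hered[OF that(3)]) (use i ts in auto)
        have "sum (pk k) (H \<inter> I k) \<le> (if k = j then 1 else 0) + \<delta>'" if "k < N" for k
        proof -
          consider "k < j" | "k = j" | "j < k" by linarith
          then show ?thesis
          proof cases
            case 1
            then have "H \<inter> I k = {}"
              using ord[OF 1 _ j(2)] Min_le[OF H(1)] by (fastforce simp: i_def)
            then show ?thesis using \<delta>' by simp
          next
            case 2
            have "sum (pk k) (H \<inter> I k) \<le> sum (pk k) (I k)"
              using posI finI by (intro sum_mono2) auto
            then show ?thesis using 2 sum1 \<delta>' by simp
          next
            case 3
            then obtain k' where k': "k = Suc k'" "j \<le> k'" by (cases k) auto
            have "i \<le> Max (I k')" using mono[OF k'(2)] Max_ge[OF finI j(2)] by simp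
            moreover have "\<forall>x\<in>s. x < i" using n1(3) I_n1[of j] j(2) by force
            ultimately have "insert i s \<in> A (Max (I k'))" using ins by (auto simp: A_def)
            moreover have "insert i s \<union> (H \<inter> I k) \<in> \<G>"
              by (rule hered[OF \<open>t \<union> H \<in> \<G>\<close>]) (use i ts in auto)
            ultimately have "sum (pk k) (H \<inter> I k) \<le> \<delta>'"
              using smallA[of k'] unfolding small_def k' by auto
            then show ?thesis using 3 by simp
          qed
        qed
        then have "sum p H \<le> (\<Sum>k<N. (1 / N) * ((if k = j then 1 else 0) + \<delta>'))"
          unfolding p_sum[OF H(1)] by (intro sum_mono mult_left_mono) auto
        also have "\<dots> = (1 / N) * (1 + N * \<delta>')"
          unfolding sum_distrib_left [symmetric] sum.distrib using j by simp
        also have "\<dots> = 1 / N + \<delta>'"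
          using N0 by (simp add: field_simps)
        finally show ?thesis using N1 by (simp add: \<delta>'_def)
      qed
    qed
  qed
  have "sum (\<lambda>i. p i / sum p H0) H \<le> \<delta>" if "t \<in> insert s F" "H \<subseteq> H0" "t \<union> H \<in> \<G>" for t H
  proof -
    have "sum p H \<le> \<delta> * sum p H0"
      using small_p[OF that] H0(2) A by (meson less_imp_le mult_left_mono order_trans)
    then show ?thesis
      using H0(2) h by (simp add: sum_divide_distrib[symmetric] pos_divide_le_eq)
  qed
  moreover have "H0 \<subseteq> {n0<..}" using H0(1) I_n1 n1(1) by (force simp: U_def)
  ultimately show "\<exists>I a p. regular_average y g' I a p \<and> I \<subseteq> {n0<..} \<and>
      (\<forall>t\<in>insert s F. \<forall>H\<subseteq>I. t \<union> H \<in> \<G> \<longrightarrow> sum p H \<le> \<delta>)"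
    using H0(4) by blast
qed

text \<open>An infinite chain of end-extensions inside \<G> would trace out an infinite set all of
  whose finite subsets lie in \<G>, by heredity. Hence the extension relation is well-founded and
  induction reaches the root \<open>{}\<close>.\<close>

lemma small_averages_well_founded:
  assumes norm1: "\<And>n. norm (y n) = 1" and low: "lower_l1 C y" "0 < C"
    and hered: "\<And>A B. A \<in> \<G> \<Longrightarrow> B \<subseteq> A \<Longrightarrow> B \<in> \<G>"
    and no_branch: "\<And>J. infinite J \<Longrightarrow> \<exists>A. finite A \<and> A \<subseteq> J \<and> A \<notin> \<G>"
  shows "small_averages y \<G> {{}}"
proof -
  define r where "r = {(insert i s, s) | i s. (\<forall>x\<in>s. x < i) \<and> insert i s \<in> \<G>}"
  have "wf r"
    unfolding wf_iff_no_infinite_down_chain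
  proof
    assume "\<exists>f. \<forall>k. (f (Suc k), f k) \<in> r"
    then obtain f where f: "\<And>k. (f (Suc k), f k) \<in> r" by blast
    then have "\<exists>i. f (Suc k) = insert i (f k) \<and> (\<forall>x\<in>f k. x < i) \<and> f (Suc k) \<in> \<G>" for k
      unfolding r_def by (smt (verit, best) mem_Collect_eq old.prod.inject)
    then obtain i where i: "\<And>k. f (Suc k) = insert (i k) (f k)" "\<And>k x. x \<in> f k \<Longrightarrow> x < i k"
        "\<And>k. f (Suc k) \<in> \<G>"
      by metis
    have mono: "f j \<subseteq> f k" if "j \<le> k" for j k
      using lift_Suc_mono_le[of f j k] i(1) that by blast
    have "i k < i (Suc k)" for k using i(1)[of k] i(2)[of "i k" "Suc k"] by auto
    then have "strict_mono i" by (simp add: strict_mono_Suc_iff)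
    then have "infinite (range i)"
      using finite_imageD strict_mono_imp_inj_on by blast
    then obtain A where A: "finite A" "A \<subseteq> range i" "A \<notin> \<G>" using no_branch by blast
    then obtain K where K: "finite K" "A = i ` K" using finite_subset_image by metis
    have "i k \<in> f (Suc (Max K))" if "k \<in> K" for k
      using mono[of "Suc k" "Suc (Max K)"] i(1)[of k] Max_ge[OF K(1) that] by auto
    then have "A \<subseteq> f (Suc (Max K))" using K by auto
    then show False using hered[OF i(3)] A(3) by blast
  qed
  \<comment> \<open>\<open>F\<close> stays arbitrary because the children of a node are adjoined one
    after another, each in the presence of those already treated.\<close>
  then have "finite s \<Longrightarrow> small_averages y \<G> F \<Longrightarrow> small_averages y \<G> (insert s F)" for s F
  proof (induction s arbitrary: F)
    case (less s)
    show ?case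
    proof (rule small_averages_insert[OF low hered less.prems(1)])
      fix m
      \<comment> \<open>The strict bound makes \<open>A 0\<close> empty, so that induction on
        \<open>k\<close> adds at most one child per step; the set required is
        \<open>A (Suc m)\<close>.\<close>
      define A where "A k = {insert i s | i. i < k \<and> (\<forall>x\<in>s. x < i) \<and> insert i s \<in> \<G>}" for k
      have "small_averages y \<G> (F \<union> A k)" for k
      proof (induction k)
        case 0
        then show ?case using less.prems by (simp add: A_def)
      next
        case (Suc k)
        show ?case
        proof (cases "(\<forall>x\<in>s. x < k) \<and> insert k s \<in> \<G>")
          case True
          then have "A (Suc k) = insert (insert k s) (A k)"
            by (auto simp: A_def less_Suc_eq)
          moreover have "(insert k s, s) \<in> r" using True by (auto simp: r_def)
          ultimately show ?thesis using less.IH[OF _ _ Suc] less.prems(1) by simp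
        next
          case False
          then have "A (Suc k) = A k" by (auto simp: A_def less_Suc_eq)
          then show ?thesis using Suc by simp
        qed
      qed
      from this[of "Suc m"] show "small_averages y \<G>
          (F \<union> {insert i s | i. i \<le> m \<and> (\<forall>x\<in>s. x < i) \<and> insert i s \<in> \<G>})"
        by (simp add: A_def less_Suc_eq_le)
    qed
  qed
  from this[OF finite.emptyI small_averages_empty[OF norm1]] show ?thesis .
qed

subsection \<open>Clopen partitions\<close>

text \<open>Compactness is applied to the cover by \<open>W\<close> and the complements of the
  members of \<T>.\<close>

lemma finite_Inter_subset_of_compact:
  fixes \<T> :: "'k::topological_space set set"
  assumes K: "compact_space (euclidean :: 'k topology)" and cl: "\<And>V. V \<in> \<T> \<Longrightarrow> closed V"
    and W: "open W" "\<Inter>\<T> \<subseteq> W"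
  obtains \<F> where "finite \<F>" "\<F> \<subseteq> \<T>" "\<Inter>\<F> \<subseteq> W"
proof -
  have "compact (UNIV :: 'k set)"
    using K by (simp add: compact_space_def)
  moreover have "UNIV \<subseteq> \<Union>(insert W (uminus ` \<T>))" using W by auto
  ultimately obtain \<D> where \<D>: "\<D> \<subseteq> insert W (uminus ` \<T>)" "finite \<D>" "UNIV \<subseteq> \<Union>\<D>"
    by (rule compactE) (use W cl in auto)
  define \<F> where "\<F> = {V \<in> \<T>. - V \<in> \<D>}"
  have "V \<in> uminus ` \<D>" if "V \<in> \<F>" for V
    using that imageI[of "- V" \<D> uminus] by (simp add: \<F>_def)
  then have "\<F> \<subseteq> uminus ` \<D>" by blast
  then have "finite \<F>" using \<D>(2) finite_subset by blast
  moreover have "\<Inter>\<F> \<subseteq> W"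
  proof
    fix x assume x: "x \<in> \<Inter>\<F>"
    obtain B where B: "B \<in> \<D>" "x \<in> B" using \<D>(3) by auto
    then have "B = W \<or> - B \<in> \<F>" using \<D>(1) by (auto simp: \<F>_def)
    then show "x \<in> W" using x B by auto
  qed
  ultimately show ?thesis using that by (auto simp: \<F>_def)
qed

text \<open>In a compact Hausdorff space the intersection of all clopen neighbourhoods of a point is
  connected, hence trivial if the space is totally disconnected.\<close>

lemma clopen_neighbourhood:
  fixes x :: "'k::topological_space"
  assumes K: "compact_space (euclidean :: 'k topology)" "Hausdorff_space (euclidean :: 'k topology)"
    "totally_disconnected_space (euclidean :: 'k topology)"
    and W: "open W" "x \<in> W"
  obtains V where "open V" "closed V" "x \<in> V" "V \<subseteq> W"
proof -
  define \<T> where "\<T> = {V. open V \<and> closed V \<and> x \<in> V}"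
  \<comment> \<open>Clopen neighbourhoods of \<open>x\<close> are stable under finite intersections,
    so a single one fits into any open set around their common part.\<close>
  have fin: "\<exists>V\<in>\<T>. V \<subseteq> U" if U: "open U" "\<Inter>\<T> \<subseteq> U" for U
  proof -
    obtain \<F> where \<F>: "finite \<F>" "\<F> \<subseteq> \<T>" "\<Inter>\<F> \<subseteq> U"
      by (rule finite_Inter_subset_of_compact[OF K(1) _ U]) (simp add: \<T>_def)
    then have "\<Inter>\<F> \<in> \<T>" by (auto simp: \<T>_def intro!: open_Inter closed_Inter)
    then show ?thesis using \<F> by blast
  qed
  have "connected (\<Inter>\<T>)"
    unfolding connected_closed
  proof (rule notI, elim exE conjE)
    fix A B
    assume AB: "closed A" "closed B" "\<Inter>\<T> \<subseteq> A \<union> B" "A \<inter> B \<inter> \<Inter>\<T> = {}"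
      "A \<inter> \<Inter>\<T> \<noteq> {}" "B \<inter> \<Inter>\<T> \<noteq> {}"
    \<comment> \<open>By symmetry \<open>x\<close> may be assumed to lie in \<open>A\<close>.
      Disjoint open sets \<open>U\<close> and \<open>V\<close> separate the two pieces, and a member
      \<open>T\<close> of \<T> inside \<open>U \<union> V\<close> is cut by \<open>U\<close> into a
      smaller clopen neighbourhood of \<open>x\<close>, which misses the piece in
      \<open>B\<close>.\<close>
    have no: False if "closed A" "closed B" "\<Inter>\<T> \<subseteq> A \<union> B" "A \<inter> B \<inter> \<Inter>\<T> = {}"
      "B \<inter> \<Inter>\<T> \<noteq> {}" "x \<in> A" for A B
    proof -
      have "closed (\<Inter>\<T>)" by (auto simp: \<T>_def)
      then have "closedin euclidean (A \<inter> \<Inter>\<T>)" "closedin euclidean (B \<inter> \<Inter>\<T>)"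
        using that(1,2) by (simp_all add: closed_Int)
      note this [THEN closedin_compact_space[OF K(1)]]
      moreover have "disjnt (A \<inter> \<Inter>\<T>) (B \<inter> \<Inter>\<T>)" using that by (auto simp: disjnt_def)
      ultimately obtain U V where UV: "open U" "open V" "A \<inter> \<Inter>\<T> \<subseteq> U" "B \<inter> \<Inter>\<T> \<subseteq> V" "disjnt U V"
        using Hausdorff_space_compact_separation[OF K(2)] by (metis open_openin)
      have "\<Inter>\<T> \<subseteq> U \<union> V" using UV that by blast
      then obtain T where T: "T \<in> \<T>" "T \<subseteq> U \<union> V" using fin UV by (meson open_Un)
      have "T \<inter> U = T - V" using T UV by (auto simp: disjnt_def)
      then have "closed (T \<inter> U)" using T UV by (auto simp: \<T>_def closed_Diff)
      moreover have "open (T \<inter> U)" using T UV by (auto simp: \<T>_def)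
      moreover have "x \<in> T \<inter> U" using T UV that by (auto simp: \<T>_def)
      ultimately have "T \<inter> U \<in> \<T>" by (simp add: \<T>_def)
      then have "\<Inter>\<T> \<subseteq> U" by blast
      then show False using that(5) UV(4,5) unfolding disjnt_def by blast
    qed
    have "x \<in> \<Inter>\<T>" by (auto simp: \<T>_def)
    then have "x \<in> A \<or> x \<in> B" using AB by blast
    then show False using no[of A B] no[of B A] AB by (auto simp: Un_commute Int_commute)
  qed
  then have "\<exists>z. \<Inter>\<T> \<subseteq> {z}"
    using K(3) by (simp add: totally_disconnected_space_def)
  moreover have "x \<in> \<Inter>\<T>" by (auto simp: \<T>_def)
  ultimately have "\<Inter>\<T> \<subseteq> W" using W by blast
  then show ?thesis using fin[OF W(1)] that by (auto simp: \<T>_def)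
qed

definition clopen_partition :: "'k::topological_space set set \<Rightarrow> bool"
  where "clopen_partition \<pi> \<longleftrightarrow> finite \<pi> \<and> partition_on UNIV \<pi> \<and> (\<forall>V\<in>\<pi>. open V \<and> closed V)"

lemma clopen_partition_UNIV: "clopen_partition {UNIV}"
  by (auto simp: clopen_partition_def partition_on_def)

lemma clopen_partition_cell:
  assumes "clopen_partition \<pi>"
  obtains U where "U \<in> \<pi>" "x \<in> U" "\<And>V. V \<in> \<pi> \<Longrightarrow> x \<in> V \<longleftrightarrow> V = U"
proof -
  have "x \<in> \<Union>\<pi>"
    using assms by (simp add: clopen_partition_def partition_on_def)
  then obtain U where "U \<in> \<pi>" "x \<in> U" by blast
  then show ?thesis
    using that assms unfolding clopen_partition_def partition_on_def disjoint_def by (metis IntI empty_iff)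
qed

text \<open>The sets are made disjoint one at a time: a new set contributes its difference with the
  union of the earlier ones, which is again clopen. Empty differences are dropped, since cells must
  be non-empty.\<close>

lemma clopen_cover_refinement:
  assumes "finite \<V>" "\<And>V. V \<in> \<V> \<Longrightarrow> open V \<and> closed V"
  shows "\<exists>\<pi>. finite \<pi> \<and> partition_on (\<Union>\<V>) \<pi> \<and> (\<forall>V\<in>\<pi>. open V \<and> closed V \<and> (\<exists>U\<in>\<V>. V \<subseteq> U))"
  using assms
proof (induction \<V>)
  case empty
  then show ?case by (intro exI[of _ "{}"]) (simp add: partition_on_def)
next
  case (insert U \<V>)
  then obtain \<pi> where \<pi>: "finite \<pi>" "partition_on (\<Union>\<V>) \<pi>"
      "\<And>V. V \<in> \<pi> \<Longrightarrow> open V \<and> closed V \<and> (\<exists>U\<in>\<V>. V \<subseteq> U)"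
    by auto
  define D where "D = U - \<Union>\<V>"
  have "open (\<Union>\<V>)" "closed (\<Union>\<V>)" using insert by (auto intro: closed_Union)
  then have D: "open D" "closed D" using insert.prems by (auto simp: D_def)
  have "partition_on (\<Union>(insert U \<V>)) (insert D \<pi> - {{}})"
  proof (rule partition_onI)
    show "\<Union>(insert D \<pi> - {{}}) = \<Union>(insert U \<V>)"
      using partition_onD1[OF \<pi>(2)] by (auto simp: D_def)
    have DV: "disjnt D V" if "V \<in> \<pi>" for V
      using partition_onD1[OF \<pi>(2)] that by (auto simp: D_def disjnt_def)
    show "disjnt A B" if "A \<in> insert D \<pi> - {{}}" "B \<in> insert D \<pi> - {{}}" "A \<noteq> B" for A B
      using that DV disjnt_sym partition_onD2[OF \<pi>(2)] unfolding pairwise_def by auto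
  qed auto
  then show ?case
    using \<pi> D by (intro exI[of _ "insert D \<pi> - {{}}"]) (auto simp: D_def)
qed

text \<open>Each point has a clopen neighbourhood inside one cell of \<pi> on which the finitely
  many functions oscillate little; a finite subcover is then made disjoint.\<close>

lemma clopen_partition_refinement:
  fixes \<pi> :: "'k::topological_space set set" and f :: "'i \<Rightarrow> 'k C"
  assumes K: "compact_space (euclidean :: 'k topology)" "Hausdorff_space (euclidean :: 'k topology)"
    "totally_disconnected_space (euclidean :: 'k topology)"
    and \<pi>: "clopen_partition \<pi>" and "finite I" "0 < t"
  obtains \<pi>' where "clopen_partition \<pi>'" "refines UNIV \<pi>' \<pi>"
    "\<And>V i x z. V \<in> \<pi>' \<Longrightarrow> i \<in> I \<Longrightarrow> x \<in> V \<Longrightarrow> z \<in> V \<Longrightarrow> \<bar>f i x - f i z\<bar> \<le> t"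
proof -
  define good where "good V \<longleftrightarrow> open V \<and> closed V \<and> (\<exists>U\<in>\<pi>. V \<subseteq> U) \<and>
    (\<forall>i\<in>I. \<forall>x\<in>V. \<forall>z\<in>V. \<bar>f i x - f i z\<bar> \<le> t)" for V
  have "\<exists>V. good V \<and> x \<in> V" for x
  proof -
    obtain U where U: "U \<in> \<pi>" "x \<in> U" using clopen_partition_cell[OF \<pi>] by metis
    define W where "W = U \<inter> (\<Inter>i\<in>I. {z. \<bar>f i z - f i x\<bar> < t / 2})"
    have "open {z. \<bar>f i z - f i x\<bar> < t / 2}" for i
      by (intro open_Collect_less continuous_intros) auto
    then have "open W" using U \<pi> \<open>finite I\<close> by (auto simp: W_def clopen_partition_def)
    moreover have "x \<in> W" using U \<open>0 < t\<close> by (auto simp: W_def)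
    ultimately obtain V where V: "open V" "closed V" "x \<in> V" "V \<subseteq> W"
      using clopen_neighbourhood[OF K] by metis
    have "\<bar>f i y - f i z\<bar> \<le> t" if "i \<in> I" "y \<in> V" "z \<in> V" for i y z
    proof -
      have "\<bar>f i y - f i x\<bar> < t / 2" "\<bar>f i z - f i x\<bar> < t / 2" using that V by (auto simp: W_def)
      then show ?thesis by linarith
    qed
    then have "good V" using V U unfolding good_def W_def by blast
    then show ?thesis using V by blast
  qed
  then have cover: "UNIV \<subseteq> \<Union>{V. good V}" by blast
  have cpt: "compact (UNIV :: 'k set)" using K by (simp add: compact_space_def)
  have opn: "\<And>V. V \<in> {V. good V} \<Longrightarrow> open V" by (simp add: good_def)
  obtain \<V> where \<V>: "\<V> \<subseteq> {V. good V}" "finite \<V>" "UNIV \<subseteq> \<Union>\<V>"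
    by (rule compactE[OF cpt cover opn])
  have good: "good V" if "V \<in> \<V>" for V using \<V>(1) that by blast
  then have "open V \<and> closed V" if "V \<in> \<V>" for V using that by (simp add: good_def)
  from clopen_cover_refinement[OF \<V>(2) this]
  obtain \<pi>' where \<pi>': "finite \<pi>'" "partition_on (\<Union>\<V>) \<pi>'"
      "\<And>V. V \<in> \<pi>' \<Longrightarrow> open V \<and> closed V \<and> (\<exists>U\<in>\<V>. V \<subseteq> U)"
    by metis
  have "\<Union>\<V> = UNIV" using \<V> by auto
  then have cp: "clopen_partition \<pi>'" using \<pi>' by (auto simp: clopen_partition_def)
  have sub: "(\<exists>U\<in>\<pi>. V \<subseteq> U) \<and> (\<forall>i\<in>I. \<forall>x\<in>V. \<forall>z\<in>V. \<bar>f i x - f i z\<bar> \<le> t)" if V: "V \<in> \<pi>'" for V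
  proof -
    obtain U where U: "U \<in> \<V>" "V \<subseteq> U" using \<pi>'(3)[OF V] by blast
    show ?thesis using good[OF U(1)] U(2) unfolding good_def by (meson subset_iff)
  qed
  then have "refines UNIV \<pi>' \<pi>"
    using cp \<pi> unfolding refines_def clopen_partition_def by simp
  then show ?thesis using that[OF cp] sub by simp
qed

section \<open>Functionals tested on step functions over clopen partitions\<close>

text \<open>The abstraction \<open>Bcontfun\<close> is meaningful only for clopen \<open>V\<close>,
  where the indicator is continuous.\<close>

definition clopen_indicator :: "'k::topological_space set \<Rightarrow> 'k C"
  where "clopen_indicator V = Bcontfun (indicat_real V)"

lemma clopen_indicator_apply:
  assumes "open V" "closed V"
  shows "clopen_indicator V x = indicat_real V x"
proof -
  have "continuous_on UNIV (indicat_real V)"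
    unfolding continuous_on_open_vimage[OF open_UNIV]
  proof (intro allI impI)
    fix B :: "real set"
    have "indicat_real V -` B \<inter> UNIV =
        (if 1 \<in> B then V else {}) \<union> (if 0 \<in> B then - V else {})"
      by (auto simp: indicator_def of_bool_def split: if_splits)
    then show "open (indicat_real V -` B \<inter> UNIV)" using assms by auto
  qed
  then have "indicat_real V \<in> bcontfun"
    by (rule bcontfun_normI[where b = 1]) (simp add: indicator_def)
  then show ?thesis by (simp add: clopen_indicator_def Bcontfun_inverse)
qed

text \<open>Only the values of the represented measure on clopen sets are used.\<close>

definition charge :: "'k::topological_space C_dual \<Rightarrow> 'k set \<Rightarrow> real"
  where "charge \<mu> V = blinfun_apply \<mu> (clopen_indicator V)"

lemma charge_diff: "charge (\<mu> - \<nu>) V = charge \<mu> V - charge \<nu> V"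
  by (simp add: charge_def blinfun.diff_left)

lemma simple_function_apply:
  assumes "clopen_partition \<pi>" "\<sigma> \<subseteq> \<pi>" "U \<in> \<pi>" "x \<in> U"
  shows "(\<Sum>V\<in>\<sigma>. c V *\<^sub>R clopen_indicator V) x = (if U \<in> \<sigma> then c U else 0)"
proof -
  have fin: "finite \<sigma>" using assms finite_subset by (auto simp: clopen_partition_def)
  have ap: "apply_bcontfun (\<Sum>V\<in>\<sigma>. c V *\<^sub>R clopen_indicator V) x = (\<Sum>V\<in>\<sigma>. c V * clopen_indicator V x)"
    using fin by (induction \<sigma>) auto
  have cell: "x \<in> V \<longleftrightarrow> V = U" if "V \<in> \<pi>" for V
    using clopen_partition_cell[OF assms(1), of x] assms(3,4) that by metis
  have "c V * clopen_indicator V x = (if V = U then c U else 0)" if "V \<in> \<sigma>" for V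
    using that assms(1,2) cell[of V] clopen_indicator_apply[of V x]
    by (auto simp: clopen_partition_def indicator_def)
  then show ?thesis using fin ap by simp
qed

text \<open>Test \<open>\<mu>\<close> on the step function whose value on each cell of \<sigma> is
  the sign of the charge; its norm is at most 1.\<close>

lemma sum_charge_le_norm:
  assumes "clopen_partition \<pi>" "\<sigma> \<subseteq> \<pi>"
  shows "(\<Sum>V\<in>\<sigma>. \<bar>charge \<mu> V\<bar>) \<le> norm \<mu>"
proof -
  let ?f = "\<Sum>V\<in>\<sigma>. sgn (charge \<mu> V) *\<^sub>R clopen_indicator V"
  have "norm (?f x) \<le> 1" for x
  proof -
    obtain U where U: "U \<in> \<pi>" "x \<in> U" using clopen_partition_cell[OF assms(1)] by metis
    show ?thesis using simple_function_apply[OF assms U, of "\<lambda>V. sgn (charge \<mu> V)"]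
      by (simp add: sgn_if)
  qed
  then have "norm ?f \<le> 1" by (rule norm_bound)
  then have "norm \<mu> * norm ?f \<le> norm \<mu>" by (simp add: mult_left_le)
  moreover have "blinfun_apply \<mu> ?f = (\<Sum>V\<in>\<sigma>. \<bar>charge \<mu> V\<bar>)"
    by (simp add: blinfun.sum_right blinfun.scaleR_right charge_def abs_sgn mult.commute)
  ultimately show ?thesis using norm_blinfun[of \<mu> ?f] by simp
qed

text \<open>This transfers smallness on clopen sets from a dense sequence to nearby functionals,
  uniformly in the partition.\<close>

lemma sum_charge_perturb:
  assumes "clopen_partition \<pi>" "\<sigma> \<subseteq> \<pi>"
  shows "(\<Sum>V\<in>\<sigma>. \<bar>charge \<mu> V\<bar>) \<le> (\<Sum>V\<in>\<sigma>. \<bar>charge \<nu> V\<bar>) + norm (\<mu> - \<nu>)"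
proof -
  have "(\<Sum>V\<in>\<sigma>. \<bar>charge \<mu> V\<bar>) \<le> (\<Sum>V\<in>\<sigma>. \<bar>charge \<nu> V\<bar> + \<bar>charge (\<mu> - \<nu>) V\<bar>)"
    by (intro sum_mono) (simp add: charge_diff)
  then show ?thesis
    using sum_charge_le_norm[OF assms, of "\<mu> - \<nu>"] by (simp add: sum.distrib)
qed

text \<open>The indicator of \<open>U\<close> is the sum of the indicators of the finer cells inside
  it.\<close>

lemma abs_charge_le_refinement:
  assumes "clopen_partition \<pi>" "clopen_partition \<pi>'" "refines UNIV \<pi>' \<pi>" "U \<in> \<pi>"
  shows "\<bar>charge \<mu> U\<bar> \<le> (\<Sum>V\<in>{V\<in>\<pi>'. V \<subseteq> U}. \<bar>charge \<mu> V\<bar>)"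
proof -
  let ?\<sigma> = "{V\<in>\<pi>'. V \<subseteq> U}"
  have "clopen_indicator U = (\<Sum>V\<in>?\<sigma>. 1 *\<^sub>R clopen_indicator V)"
  proof (rule bcontfun_eqI)
    fix x
    obtain V where V: "V \<in> \<pi>'" "x \<in> V" using clopen_partition_cell[OF assms(2)] by metis
    obtain U' where U': "U' \<in> \<pi>" "V \<subseteq> U'" using assms(3) V by (auto simp: refines_def)
    have "V \<subseteq> U \<longleftrightarrow> x \<in> U"
      using clopen_partition_cell[OF assms(1), of x] assms(4) U' V by (metis subsetD)
    then show "clopen_indicator U x = (\<Sum>V\<in>?\<sigma>. 1 *\<^sub>R clopen_indicator V) x"
      using simple_function_apply[OF assms(2) _ V, of ?\<sigma> "\<lambda>_. 1"] V assms(1,4) clopen_indicator_apply[of U x]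
      by (auto simp: clopen_partition_def indicator_def)
  qed
  then have "charge \<mu> U = (\<Sum>V\<in>?\<sigma>. charge \<mu> V)"
    by (simp add: charge_def blinfun.sum_right)
  then show ?thesis by (simp add: sum_abs)
qed

text \<open>Replace \<open>f\<close> by the step function with values \<open>c V\<close>, at uniform
  distance at most \<open>t\<close>.\<close>

lemma abs_apply_le_charge:
  fixes f :: "'k::topological_space C"
  assumes \<pi>: "clopen_partition \<pi>"
    and osc: "\<And>V x. V \<in> \<pi> \<Longrightarrow> x \<in> V \<Longrightarrow> \<bar>f x - c V\<bar> \<le> t"
  shows "\<bar>blinfun_apply \<mu> f\<bar> \<le> norm \<mu> * t + (\<Sum>V\<in>\<pi>. \<bar>charge \<mu> V\<bar> * \<bar>c V\<bar>)"
proof -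
  let ?g = "\<Sum>V\<in>\<pi>. c V *\<^sub>R clopen_indicator V"
  have "norm ((f - ?g) x) \<le> t" for x
  proof -
    obtain U where U: "U \<in> \<pi>" "x \<in> U" using clopen_partition_cell[OF \<pi>] by metis
    show ?thesis using simple_function_apply[OF \<pi> _ U, of \<pi> c] osc[OF U] U by simp
  qed
  then have "norm (f - ?g) \<le> t" by (rule norm_bound)
  then have "norm \<mu> * norm (f - ?g) \<le> norm \<mu> * t" by (simp add: mult_left_mono)
  then have 1: "\<bar>blinfun_apply \<mu> (f - ?g)\<bar> \<le> norm \<mu> * t"
    using norm_blinfun[of \<mu> "f - ?g"] by simp
  have "blinfun_apply \<mu> ?g = (\<Sum>V\<in>\<pi>. c V * charge \<mu> V)"
    by (simp add: blinfun.sum_right blinfun.scaleR_right charge_def)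
  then have 2: "\<bar>blinfun_apply \<mu> ?g\<bar> \<le> (\<Sum>V\<in>\<pi>. \<bar>charge \<mu> V\<bar> * \<bar>c V\<bar>)"
    using sum_abs[of "\<lambda>V. c V * charge \<mu> V" \<pi>] by (simp add: abs_mult mult.commute)
  show ?thesis using 1 2 by (simp add: blinfun.diff_right)
qed

subsection \<open>Blocks that are small in measure\<close>

text \<open>Averaged over all signs, the cross terms cancel. The signs are fixed one at a time: by
  the parallelogram identity the two choices for a new sign have the desired bound as their mean, so
  one of them satisfies it.\<close>

lemma signs_square_sum_le:
  fixes f :: "'i \<Rightarrow> 'v \<Rightarrow> real"
  assumes "finite I" "finite A" "\<And>V. V \<in> A \<Longrightarrow> 0 \<le> w V"
  shows "\<exists>s :: 'i \<Rightarrow> real. (\<forall>i. \<bar>s i\<bar> = 1) \<and>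
    (\<Sum>V\<in>A. w V * (\<Sum>i\<in>I. s i * f i V)\<^sup>2) \<le> (\<Sum>i\<in>I. \<Sum>V\<in>A. w V * (f i V)\<^sup>2)"
  using assms(1)
proof (induction I)
  case empty
  then show ?case by (intro exI[of _ "\<lambda>_. 1"]) simp
next
  case (insert i I)
  then obtain s :: "'i \<Rightarrow> real" where s: "\<And>i. \<bar>s i\<bar> = 1"
      "(\<Sum>V\<in>A. w V * (\<Sum>i\<in>I. s i * f i V)\<^sup>2) \<le> (\<Sum>i\<in>I. \<Sum>V\<in>A. w V * (f i V)\<^sup>2)"
    by blast
  define g where "g V = (\<Sum>i\<in>I. s i * f i V)" for V
  define h where "h = f i"
  have "(\<Sum>V\<in>A. w V * (h V + g V)\<^sup>2) + (\<Sum>V\<in>A. w V * (- h V + g V)\<^sup>2) =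
      2 * (\<Sum>V\<in>A. w V * (h V)\<^sup>2) + 2 * (\<Sum>V\<in>A. w V * (g V)\<^sup>2)"
    unfolding sum_distrib_left sum.distrib [symmetric]
    by (intro sum.cong refl) (simp add: power2_eq_square algebra_simps)
  then obtain r :: real where r: "\<bar>r\<bar> = 1"
      "(\<Sum>V\<in>A. w V * (r * h V + g V)\<^sup>2) \<le> (\<Sum>V\<in>A. w V * (h V)\<^sup>2) + (\<Sum>V\<in>A. w V * (g V)\<^sup>2)"
  proof (cases "(\<Sum>V\<in>A. w V * (h V + g V)\<^sup>2) \<le> (\<Sum>V\<in>A. w V * (h V)\<^sup>2) + (\<Sum>V\<in>A. w V * (g V)\<^sup>2)")
    case True
    then show ?thesis using that[of 1] by simp
  next
    case False
    assume "(\<Sum>V\<in>A. w V * (h V + g V)\<^sup>2) + (\<Sum>V\<in>A. w V * (- h V + g V)\<^sup>2) =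
      2 * (\<Sum>V\<in>A. w V * (h V)\<^sup>2) + 2 * (\<Sum>V\<in>A. w V * (g V)\<^sup>2)"
    then have "(\<Sum>V\<in>A. w V * (- h V + g V)\<^sup>2) \<le> (\<Sum>V\<in>A. w V * (h V)\<^sup>2) + (\<Sum>V\<in>A. w V * (g V)\<^sup>2)"
      using False by linarith
    then show ?thesis using that[of "-1"] by simp
  qed
  have "(\<Sum>j\<in>insert i I. (s(i := r)) j * f j V) = r * h V + g V" for V
    using insert by (simp add: g_def h_def) (intro sum.cong, auto)
  then have "(\<Sum>V\<in>A. w V * (\<Sum>j\<in>insert i I. (s(i := r)) j * f j V)\<^sup>2) \<le>
      (\<Sum>V\<in>A. w V * (h V)\<^sup>2) + (\<Sum>V\<in>A. w V * (g V)\<^sup>2)"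
    using r by simp
  also have "\<dots> \<le> (\<Sum>j\<in>insert i I. \<Sum>V\<in>A. w V * (f j V)\<^sup>2)"
    using s insert by (simp add: g_def h_def)
  finally show ?case using r s by (intro exI[of _ "s(i := r)"]) simp
qed

definition asymptotic_l1_bound :: "real \<Rightarrow> (nat \<Rightarrow> 'v::real_normed_vector) \<Rightarrow> bool"
  where "asymptotic_l1_bound C e \<longleftrightarrow> (\<forall>m\<ge>1. \<forall>u F. block_basis e m u F \<and> m \<le> Min (F 1) \<longrightarrow>
      norm (\<Sum>i=1..m. u i) \<ge> C * (\<Sum>i=1..m. norm (u i)))"

text \<open>Single signed basis vectors are blocks; \<open>n\<close> of them are admissible because
  the first sits at \<open>m + 1\<close>, beyond \<open>n\<close>.\<close>

lemma norm_signed_sum_ge: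
  assumes norm1: "\<And>n. 1 \<le> n \<Longrightarrow> norm (e n) = 1" and low: "asymptotic_l1_bound C e"
    and n: "1 \<le> n" "n \<le> m" and s: "\<And>i. \<bar>s i\<bar> = (1::real)"
  shows "C * n \<le> norm (\<Sum>i\<in>{m+1..m+n}. s i *\<^sub>R e i)"
proof -
  define u where "u i = s (m + i) *\<^sub>R e (m + i)" for i
  have s0: "s i \<noteq> 0" for i using s[of i] by auto
  have "block_basis e n u (\<lambda>i. {m + i})"
    unfolding block_basis_def
  proof (intro conjI exI[of _ s] ballI)
    fix i assume "i \<in> {1..n}"
    then have "norm (u i) = 1" by (simp add: u_def s norm1)
    then show "u i \<noteq> 0" by auto
  qed (auto simp: u_def s0)
  then have "C * (\<Sum>i=1..n. norm (u i)) \<le> norm (\<Sum>i=1..n. u i)"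
    using low [unfolded asymptotic_l1_bound_def, rule_format, of n u "\<lambda>i. {m + i}"] n by simp
  moreover have "(\<Sum>i=1..n. norm (u i)) = n"
    by (simp add: u_def s norm1)
  moreover have "(\<Sum>i=1..n. u i) = (\<Sum>i\<in>{m+1..m+n}. s i *\<^sub>R e i)"
    using sum.shift_bounds_cl_nat_ivl[of "\<lambda>i. s i *\<^sub>R e i" 1 m n] by (simp add: u_def add.commute)
  ultimately show ?thesis by simp
qed

text \<open>For a clopen partition the union of these cells is a clopen set containing every point
  where \<open>f\<close> exceeds \<open>t\<close> in absolute value. Keeping the cells separate lets
  its mass be read off from charges.\<close>

definition large_cells :: "'k::topological_space set set \<Rightarrow> 'k C \<Rightarrow> real \<Rightarrow> 'k set set"
  where "large_cells \<pi> f t = {V\<in>\<pi>. \<exists>x\<in>V. t < \<bar>f x\<bar>}"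

definition oscillation_le :: "'k::topological_space set set \<Rightarrow> 'k C \<Rightarrow> real \<Rightarrow> bool"
  where "oscillation_le \<pi> f t \<longleftrightarrow> (\<forall>V\<in>\<pi>. \<forall>x\<in>V. \<forall>z\<in>V. \<bar>f x - f z\<bar> \<le> t)"

lemma apply_bcontfun_sum: "apply_bcontfun (\<Sum>i\<in>I. f i) x = (\<Sum>i\<in>I. apply_bcontfun (f i) x)"
  for f :: "'i \<Rightarrow> 'k::topological_space C"
  by (induction I rule: infinite_finite_induct) auto

text \<open>A signed sum of \<open>n\<close> basis vectors has norm at least \<open>C n\<close>, whereas suitable signs make it
  of order \<open>sqrt n\<close> in the mean square with respect to finitely many given functionals.\<close>

lemma small_block_vector:
  fixes e :: "nat \<Rightarrow> 'k::topological_space C"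
  assumes K: "compact_space (euclidean :: 'k topology)" "Hausdorff_space (euclidean :: 'k topology)"
    "totally_disconnected_space (euclidean :: 'k topology)"
    and norm1: "\<And>n. 1 \<le> n \<Longrightarrow> norm (e n) = 1" and low: "asymptotic_l1_bound C e" "0 < C"
    and \<pi>: "clopen_partition \<pi>" and D: "finite D" "\<And>\<mu>. \<mu> \<in> D \<Longrightarrow> norm \<mu> \<le> 1"
    and pos: "0 < \<epsilon>" "0 < t"
  obtains E c \<pi>' where "finite E" "E \<noteq> {}" "E \<subseteq> {m<..}" "\<And>i. i \<in> E \<Longrightarrow> c i \<noteq> 0"
    "norm (\<Sum>i\<in>E. c i *\<^sub>R e i) = 1" "clopen_partition \<pi>'" "refines UNIV \<pi>' \<pi>"
    "oscillation_le \<pi>' (\<Sum>i\<in>E. c i *\<^sub>R e i) t"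
    "\<And>\<mu>. \<mu> \<in> D \<Longrightarrow> (\<Sum>V\<in>large_cells \<pi>' (\<Sum>i\<in>E. c i *\<^sub>R e i) t. \<bar>charge \<mu> V\<bar>) \<le> \<epsilon>"
proof -
  \<comment> \<open>Chosen so that the Chebyshev bound
    \<open>4 * card D / (t\<^sup>2 * C\<^sup>2 * n)\<close> obtained below is at most
    \<epsilon>.\<close>
  obtain n :: nat where n: "4 * card D / (t\<^sup>2 * C\<^sup>2 * \<epsilon>) < n"
    using reals_Archimedean2 by blast
  have n0: "0 < n" using n pos low(2)
    by (metis divide_nonneg_pos gr0I mult_nonneg_nonneg mult_pos_pos of_nat_0 of_nat_0_le_iff
        linorder_not_less zero_le_numeral zero_less_power)
  have n1: "4 * card D \<le> \<epsilon> * (t\<^sup>2 * C\<^sup>2 * n)"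
    using n pos low(2) by (simp add: field_simps)
  \<comment> \<open>The offset \<open>m\<close> is required by the conclusion, the further offset
    \<open>n\<close> makes the \<open>n\<close> vectors admissible.\<close>
  define E where "E = {(m + n) + 1..(m + n) + n}"
  have E: "finite E" "E \<noteq> {}" "E \<subseteq> {m<..}" "card E = n"
    using n0 by (auto simp: E_def)
  \<comment> \<open>The sum of \<open>n\<close> functions oscillating by \<open>t * C / 2\<close>,
    divided by a norm of at least \<open>C * n\<close>, oscillates by at most
    \<open>t / 2\<close>.\<close>
  obtain \<pi>' where \<pi>': "clopen_partition \<pi>'" "refines UNIV \<pi>' \<pi>"
      and osc: "\<And>V i x z. V \<in> \<pi>' \<Longrightarrow> i \<in> E \<Longrightarrow> x \<in> V \<Longrightarrow> z \<in> V \<Longrightarrow> \<bar>e i x - e i z\<bar> \<le> t * C / 2"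
    using clopen_partition_refinement[OF K \<pi> E(1), of "t * C / 2" e] pos low(2)
    by (metis half_gt_zero mult_pos_pos)
  have fin: "finite \<pi>'" and ne: "\<And>V. V \<in> \<pi>' \<Longrightarrow> V \<noteq> {}"
    using \<pi>'(1) by (auto simp: clopen_partition_def partition_on_def)
  define q where "q V = (SOME x. x \<in> V)" for V :: "'k set"
  have q: "q V \<in> V" if "V \<in> \<pi>'" for V
    using ne[OF that] unfolding q_def by (simp add: some_in_eq)
  \<comment> \<open>Adding up the masses over \<open>D\<close> lets one choice of signs serve all
    functionals in \<open>D\<close>.\<close>
  define w where "w V = (\<Sum>\<mu>\<in>D. \<bar>charge \<mu> V\<bar>)" for V
  have w0: "0 \<le> w V" for V unfolding w_def by (intro sum_nonneg) auto
  obtain s :: "nat \<Rightarrow> real" where s: "\<And>i. \<bar>s i\<bar> = 1"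
      and sq: "(\<Sum>V\<in>\<pi>'. w V * (\<Sum>i\<in>E. s i * e i (q V))\<^sup>2) \<le> (\<Sum>i\<in>E. \<Sum>V\<in>\<pi>'. w V * (e i (q V))\<^sup>2)"
    using signs_square_sum_le[where w = w and f = "\<lambda>i V. e i (q V)", OF E(1) fin w0] by blast
  define z where "z = (\<Sum>i\<in>E. s i *\<^sub>R e i)"
  have z_apply: "z x = (\<Sum>i\<in>E. s i * e i x)" for x
    by (simp add: z_def apply_bcontfun_sum)
  have z_low: "C * n \<le> norm z"
    unfolding z_def E_def using norm_signed_sum_ge[OF norm1 low(1), of n "m + n" s] n0 s by simp
  have Cn: "0 < C * n" using low(2) n0 by simp
  define N where "N = norm z"
  have N: "0 < N" "C * n \<le> N" using z_low Cn by (auto simp: N_def)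
  define c where "c i = s i / N" for i
  define y where "y = (\<Sum>i\<in>E. c i *\<^sub>R e i)"
  have y_z: "y = (1 / N) *\<^sub>R z"
    unfolding y_def z_def scaleR_sum_right by (simp add: c_def)
  have y_apply: "y x = z x / N" for x by (simp add: y_z)
  have y_norm: "norm y = 1" using N by (simp add: y_z N_def)
  have y_osc: "\<bar>y x - y x'\<bar> \<le> t / 2" if "V \<in> \<pi>'" "x \<in> V" "x' \<in> V" for V x x'
  proof -
    have "\<bar>z x - z x'\<bar> = \<bar>\<Sum>i\<in>E. s i * (e i x - e i x')\<bar>"
      by (simp add: z_apply sum_subtractf algebra_simps)
    also have "\<dots> \<le> (\<Sum>i\<in>E. \<bar>s i * (e i x - e i x')\<bar>)" by (rule sum_abs)
    also have "\<dots> \<le> (\<Sum>i\<in>E. t * C / 2)"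
      using osc[OF that(1) _ that(2,3)] by (intro sum_mono) (simp add: abs_mult s)
    also have "\<dots> = (t / 2) * (C * n)" by (simp add: E(4))
    also have "\<dots> \<le> (t / 2) * N" using N pos by (intro mult_left_mono) auto
    finally have "\<bar>z x - z x'\<bar> / N \<le> t / 2" using N by (simp add: pos_divide_le_eq)
    then show ?thesis using N by (simp add: y_apply diff_divide_distrib [symmetric])
  qed
  then have "oscillation_le \<pi>' y t"
    using pos unfolding oscillation_le_def by (smt (verit) field_sum_of_halves)
  moreover have "(\<Sum>V\<in>large_cells \<pi>' y t. \<bar>charge \<mu> V\<bar>) \<le> \<epsilon>" if \<mu>: "\<mu> \<in> D" for \<mu>
  proof -
    let ?B = "large_cells \<pi>' y t"
    have B: "?B \<subseteq> \<pi>'" by (auto simp: large_cells_def)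
    \<comment> \<open>Chebyshev's inequality: on a large cell \<open>y\<close> exceeds
      \<open>t\<close> somewhere, hence is at least \<open>t / 2\<close> in absolute value at the
      sample point \<open>q V\<close>, and the weighted sum of squares bounds the weight of such
      cells.\<close>
    have "(t / 2 * (C * n))\<^sup>2 \<le> (z (q V))\<^sup>2" if V: "V \<in> ?B" for V
    proof -
      obtain x where x: "x \<in> V" "t < \<bar>y x\<bar>" "V \<in> \<pi>'" using V by (auto simp: large_cells_def)
      have "t / 2 \<le> \<bar>y (q V)\<bar>" using y_osc[OF x(3,1) q[OF x(3)]] x(2) by linarith
      then have "t / 2 * N \<le> \<bar>z (q V)\<bar>" using N by (simp add: y_apply field_simps)
      moreover have "t / 2 * (C * n) \<le> t / 2 * N" using N pos by (intro mult_left_mono) auto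
      ultimately have "t / 2 * (C * n) \<le> \<bar>z (q V)\<bar>" by linarith
      then have "(t / 2 * (C * n))\<^sup>2 \<le> \<bar>z (q V)\<bar>\<^sup>2"
        using pos Cn by (intro power_mono) auto
      then show ?thesis by simp
    qed
    then have "(\<Sum>V\<in>?B. w V * (t / 2 * (C * n))\<^sup>2) \<le> (\<Sum>V\<in>?B. w V * (z (q V))\<^sup>2)"
      using w0 by (intro sum_mono mult_left_mono) auto
    also have "\<dots> \<le> (\<Sum>V\<in>\<pi>'. w V * (z (q V))\<^sup>2)"
      using fin B w0 by (intro sum_mono2) auto
    also have "\<dots> \<le> (\<Sum>i\<in>E. \<Sum>V\<in>\<pi>'. w V * (e i (q V))\<^sup>2)"
      using sq by (simp add: z_apply)
    also have "\<dots> \<le> (\<Sum>i\<in>E. \<Sum>V\<in>\<pi>'. w V)"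
    proof (intro sum_mono)
      fix i V assume i: "i \<in> E"
      have "norm (e i) = 1" using i E(3) by (intro norm1) auto
      then have "\<bar>e i (q V)\<bar> \<le> 1" using norm_bounded[of "e i" "q V"] by simp
      then have "(e i (q V))\<^sup>2 \<le> 1" by (simp add: abs_square_le_1)
      then show "w V * (e i (q V))\<^sup>2 \<le> w V" using w0 by (simp add: mult_left_le)
    qed
    also have "\<dots> = n * (\<Sum>\<mu>\<in>D. \<Sum>V\<in>\<pi>'. \<bar>charge \<mu> V\<bar>)"
      unfolding w_def by (subst sum.swap) (simp add: E(4))
    also have "\<dots> \<le> real n * (\<Sum>\<mu>\<in>D. 1)"
      using sum_charge_le_norm[OF \<pi>'(1) subset_refl] D(2)
      by (intro mult_left_mono sum_mono) (auto intro: order_trans)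
    finally have le: "(\<Sum>V\<in>?B. w V * (t / 2 * (C * n))\<^sup>2) \<le> n * card D" by simp
    define W where "W = (\<Sum>V\<in>?B. w V)"
    have "W * (t / 2 * (C * n))\<^sup>2 \<le> n * card D"
      using le by (simp add: W_def sum_distrib_right)
    then have "(W * (t\<^sup>2 * C\<^sup>2 * n)) * n \<le> (4 * card D) * n"
      by (simp add: power2_eq_square algebra_simps)
    then have "W * (t\<^sup>2 * C\<^sup>2 * n) \<le> 4 * card D" using n0 by simp
    also note n1
    finally have "(\<Sum>V\<in>?B. w V) \<le> \<epsilon>" using pos low(2) n0 by (simp add: W_def)
    moreover have "\<bar>charge \<mu> V\<bar> \<le> w V" for V
      unfolding w_def using \<mu> D(1) by (intro member_le_sum) auto
    ultimately show ?thesis by (meson order_trans sum_mono)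
  qed
  moreover have "c i \<noteq> 0" for i using s[of i] N by (auto simp: c_def)
  ultimately show ?thesis using that[of E c \<pi>'] E \<pi>' y_norm unfolding y_def by simp
qed

text \<open>Iteration of \<open>small_block_vector\<close>. Stage \<open>j\<close> respects only the
  finitely many functionals up to \<open>d j\<close>, so each fixed \<open>d k\<close> is controlled
  from stage \<open>k\<close> on.\<close>

lemma small_block_sequence:
  fixes e :: "nat \<Rightarrow> 'k::topological_space C"
  assumes K: "compact_space (euclidean :: 'k topology)" "Hausdorff_space (euclidean :: 'k topology)"
    "totally_disconnected_space (euclidean :: 'k topology)"
    and norm1: "\<And>n. 1 \<le> n \<Longrightarrow> norm (e n) = 1" and low: "asymptotic_l1_bound C e" "0 < C"
    and d: "\<And>k. norm (d k) \<le> 1" and pos: "0 < \<epsilon>" "\<And>j. 0 < t j"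
  obtains E c \<pi> where "\<And>j. finite (E j)" "\<And>j. E j \<noteq> {}" "\<And>j. E j \<subseteq> {j<..}"
    "\<And>j k i l. j < k \<Longrightarrow> i \<in> E j \<Longrightarrow> l \<in> E k \<Longrightarrow> i < l" "\<And>j i. i \<in> E j \<Longrightarrow> c j i \<noteq> 0"
    "\<And>j. norm (\<Sum>i\<in>E j. c j i *\<^sub>R e i) = 1" "\<And>j. clopen_partition (\<pi> j)"
    "\<And>j k. j \<le> k \<Longrightarrow> refines UNIV (\<pi> k) (\<pi> j)"
    "\<And>j. oscillation_le (\<pi> j) (\<Sum>i\<in>E j. c j i *\<^sub>R e i) (t j)"
    "\<And>j k. k \<le> j \<Longrightarrow> (\<Sum>V\<in>large_cells (\<pi> j) (\<Sum>i\<in>E j. c j i *\<^sub>R e i) (t j). \<bar>charge (d k) V\<bar>) \<le> \<epsilon>"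
proof -
  define P where "P = (\<lambda>(j::nat) (E :: nat set, c :: nat \<Rightarrow> real, \<pi>).
    finite E \<and> E \<noteq> {} \<and> E \<subseteq> {j<..} \<and> (\<forall>i\<in>E. c i \<noteq> 0) \<and> norm (\<Sum>i\<in>E. c i *\<^sub>R e i) = 1 \<and>
    clopen_partition \<pi> \<and> oscillation_le \<pi> (\<Sum>i\<in>E. c i *\<^sub>R e i) (t j) \<and>
    (\<forall>k\<le>j. (\<Sum>V\<in>large_cells \<pi> (\<Sum>i\<in>E. c i *\<^sub>R e i) (t j). \<bar>charge (d k) V\<bar>) \<le> \<epsilon>))"
  define Q where "Q = (\<lambda>(j::nat) (E :: nat set, c :: nat \<Rightarrow> real, \<pi> :: 'k set set)
    (E' :: nat set, c' :: nat \<Rightarrow> real, \<pi>'). E' \<subseteq> {Max E<..} \<and> refines UNIV \<pi>' \<pi>)"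
  have step: "\<exists>E c \<pi>'. P j (E, c, \<pi>') \<and> E \<subseteq> {m<..} \<and> refines UNIV \<pi>' \<pi>"
    if \<pi>: "clopen_partition \<pi>" for j m \<pi>
  proof -
    have D: "finite (d ` {..j})" "\<And>\<mu>. \<mu> \<in> d ` {..j} \<Longrightarrow> norm \<mu> \<le> 1" using d by auto
    obtain E c \<pi>' where *: "finite E" "E \<noteq> {}" "E \<subseteq> {max m j<..}" "\<And>i. i \<in> E \<Longrightarrow> c i \<noteq> 0"
      "norm (\<Sum>i\<in>E. c i *\<^sub>R e i) = 1" "clopen_partition \<pi>'" "refines UNIV \<pi>' \<pi>"
      "oscillation_le \<pi>' (\<Sum>i\<in>E. c i *\<^sub>R e i) (t j)"
      "\<And>\<mu>. \<mu> \<in> d ` {..j} \<Longrightarrow> (\<Sum>V\<in>large_cells \<pi>' (\<Sum>i\<in>E. c i *\<^sub>R e i) (t j). \<bar>charge \<mu> V\<bar>) \<le> \<epsilon>"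
      by (rule small_block_vector[OF K norm1 low \<pi> D pos(1) pos(2)[of j], where m = "max m j"],
          assumption, assumption, rule that)
    have "E \<subseteq> {m<..}" "E \<subseteq> {j<..}" using *(3) by auto
    then have "P j (E, c, \<pi>') \<and> E \<subseteq> {m<..} \<and> refines UNIV \<pi>' \<pi>" using * by (simp add: P_def)
    then show ?thesis by blast
  qed
  have "\<exists>f. \<forall>j. P j (f j) \<and> Q j (f j) (f (Suc j))"
  proof (rule dependent_nat_choice)
    show "\<exists>x. P 0 x" using step[OF clopen_partition_UNIV] by blast
  next
    fix x j assume Px: "P j x"
    obtain E c \<pi> where x: "x = (E, c, \<pi>)" by (rule prod_cases3)
    then have "clopen_partition \<pi>" using Px by (simp add: P_def)
    then show "\<exists>x'. P (Suc j) x' \<and> Q j x x'"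
      using step[of \<pi> "Suc j" "Max E"] unfolding x Q_def by auto
  qed
  then obtain f where f: "\<And>j. P j (f j)" "\<And>j. Q j (f j) (f (Suc j))" by blast
  define E where "E j = fst (f j)" for j
  define c where "c j = fst (snd (f j))" for j
  define \<pi> where "\<pi> j = snd (snd (f j))" for j
  have f_eq: "f j = (E j, c j, \<pi> j)" for j by (simp add: E_def c_def \<pi>_def)
  have P: "finite (E j)" "E j \<noteq> {}" "E j \<subseteq> {j<..}" "\<And>i. i \<in> E j \<Longrightarrow> c j i \<noteq> 0"
    "norm (\<Sum>i\<in>E j. c j i *\<^sub>R e i) = 1" "clopen_partition (\<pi> j)"
    "oscillation_le (\<pi> j) (\<Sum>i\<in>E j. c j i *\<^sub>R e i) (t j)"
    "\<And>k. k \<le> j \<Longrightarrow> (\<Sum>V\<in>large_cells (\<pi> j) (\<Sum>i\<in>E j. c j i *\<^sub>R e i) (t j). \<bar>charge (d k) V\<bar>) \<le> \<epsilon>" for j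
    using f(1)[of j] by (simp_all add: f_eq P_def)
  have Q: "E (Suc j) \<subseteq> {Max (E j)<..}" "refines UNIV (\<pi> (Suc j)) (\<pi> j)" for j
    using f(2)[of j] by (simp_all add: f_eq Q_def)
  have "Max (E j) < Max (E (Suc j))" for j
    using Q(1)[of j] Max_in[OF P(1,2), of "Suc j"] by auto
  then have mono: "Max (E j) \<le> Max (E k)" if "j \<le> k" for j k
    using lift_Suc_mono_le[of "\<lambda>k. Max (E k)", OF less_imp_le that] by blast
  have ord: "i < l" if "j < k" "i \<in> E j" "l \<in> E k" for i j k l
  proof -
    obtain k' where k': "k = Suc k'" "j \<le> k'" using \<open>j < k\<close> by (cases k) auto
    have "i \<le> Max (E j)" using that P(1) by simp
    also have "\<dots> \<le> Max (E k')" using mono k' by simp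
    also have "\<dots> < l" using Q(1)[of k'] that k' by auto
    finally show ?thesis .
  qed
  have ref: "refines UNIV (\<pi> k) (\<pi> j)" if "j \<le> k" for j k
    using that
  proof (induction k rule: dec_induct)
    case base
    then show ?case using P(6) by (simp add: refines_refl clopen_partition_def)
  next
    case (step k)
    then show ?case using Q(2) refines_trans by blast
  qed
  show ?thesis using that[OF P(1-3) ord P(4-6) ref P(7,8)] .
qed

section \<open>Transfer of the lower l1 estimate to blocks\<close>

text \<open>Signed sums of the vectors over successive index groups are themselves successive blocks
  of \<open>e\<close>. They are admissible since an index \<open>i \<ge> N\<close> has its support
  \<open>E i\<close> beyond \<open>i\<close>.\<close>

lemma lower_l1_blocks:
  fixes e :: "nat \<Rightarrow> 'v::real_normed_vector"
  assumes low: "asymptotic_l1_bound C e"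
    and E: "\<And>j. finite (E j)" "\<And>j. E j \<noteq> {}" "\<And>j. E j \<subseteq> {j<..}"
    "\<And>j k i l. j < k \<Longrightarrow> i \<in> E j \<Longrightarrow> l \<in> E k \<Longrightarrow> i < l"
    and c: "\<And>j i. i \<in> E j \<Longrightarrow> c j i \<noteq> 0"
  shows "lower_l1 C (\<lambda>j. \<Sum>i\<in>E j. c j i *\<^sub>R e i)"
  unfolding lower_l1_def
proof (intro allI impI)
  define y where "y j = (\<Sum>i\<in>E j. c j i *\<^sub>R e i)" for j
  fix N :: nat and I :: "nat \<Rightarrow> nat set" and a :: "nat \<Rightarrow> real"
  assume "(\<forall>j<N. finite (I j) \<and> (\<forall>i\<in>I j. N \<le> i \<and> 0 < a i) \<and>
      0 < sign_norm (\<lambda>j. \<Sum>i\<in>E j. c j i *\<^sub>R e i) (I j) a) \<and>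
    (\<forall>j k. j < k \<and> k < N \<longrightarrow> (\<forall>i\<in>I j. \<forall>l\<in>I k. i < l))"
  then have finI: "\<And>j. j < N \<Longrightarrow> finite (I j)" and I: "\<And>j i. j < N \<Longrightarrow> i \<in> I j \<Longrightarrow> N \<le> i \<and> 0 < a i"
    and npos: "\<And>j. j < N \<Longrightarrow> 0 < sign_norm y (I j) a"
    and ordI: "\<And>j k i l. j < k \<Longrightarrow> k < N \<Longrightarrow> i \<in> I j \<Longrightarrow> l \<in> I k \<Longrightarrow> i < l"
    unfolding y_def by blast+
  have "\<exists>S. norm (sign_sum y (I j) a S) = sign_norm y (I j) a" if "j < N" for j
    using sign_norm_attained[OF finI[OF that]] by metis
  then have "\<exists>S. \<forall>j<N. norm (sign_sum y (I j) a (S j)) = sign_norm y (I j) a"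
    by metis
  then obtain S where S: "\<And>j. j < N \<Longrightarrow> norm (sign_sum y (I j) a (S j)) = sign_norm y (I j) a"
    by blast
  \<comment> \<open>The groups are disjoint, so the optimal signs of the separate groups combine
    into one choice.\<close>
  define T where "T = (\<Union>j<N. S j \<inter> I j)"
  have disjI: "j = k" if "j < N" "k < N" "i \<in> I j" "i \<in> I k" for i j k
    using ordI that by (metis less_irrefl nat_neq_iff)
  have T_eq: "i \<in> T \<longleftrightarrow> i \<in> S j" if "j < N" "i \<in> I j" for i j
    using disjI that unfolding T_def by blast
  have sum_T: "sign_sum y (I j) a T = sign_sum y (I j) a (S j)" if "j < N" for j
    unfolding sign_sum_def using T_eq[OF that] by (intro sum.cong) auto
  define \<sigma> where "\<sigma> i = (if i \<in> T then a i else - a i)" for i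
  \<comment> \<open>The index of the unique block whose support contains \<open>k\<close>; it turns
    the coefficients of the blocks into one sequence \<open>b\<close> relative to
    \<open>e\<close>.\<close>
  define \<iota> where "\<iota> k = (THE i. k \<in> E i)" for k
  have disjE: "i = j" if "k \<in> E i" "k \<in> E j" for i j k
    using E(4) that by (metis less_irrefl nat_neq_iff)
  have \<iota>: "\<iota> k = i" if "k \<in> E i" for i k
    unfolding \<iota>_def using that disjE by blast
  define b where "b k = \<sigma> (\<iota> k) * c (\<iota> k) k" for k
  \<comment> \<open>Blocks of a block basis are numbered from 1, the groups \<open>I\<close> from 0;
    hence the shift by one.\<close>
  define F where "F j = (\<Union>i\<in>I (j - 1). E i)" for j
  define u where "u j = sign_sum y (I (j - 1)) a T" for j
  have u_eq: "u j = (\<Sum>k\<in>F j. b k *\<^sub>R e k)" if "j - 1 < N" for j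
  proof -
    have "(\<Sum>k\<in>F j. b k *\<^sub>R e k) = (\<Sum>i\<in>I (j - 1). \<Sum>k\<in>E i. b k *\<^sub>R e k)"
      unfolding F_def using finI[OF that] E(1) disjE by (intro sum.UNION_disjoint) blast+
    also have "\<dots> = (\<Sum>i\<in>I (j - 1). \<sigma> i *\<^sub>R y i)"
      unfolding y_def scaleR_sum_right by (intro sum.cong refl) (simp add: b_def \<iota>)
    finally show ?thesis by (simp add: u_def sign_sum_def \<sigma>_def)
  qed
  have u_norm: "norm (u j) = sign_norm y (I (j - 1)) a" if "j - 1 < N" for j
    using that S sum_T by (simp add: u_def)
  have I_ne: "I j \<noteq> {}" if "j < N" for j using npos[OF that] by auto
  show "C * (\<Sum>j<N. sign_norm (\<lambda>j. \<Sum>i\<in>E j. c j i *\<^sub>R e i) (I j) a) \<le>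
      sign_norm (\<lambda>j. \<Sum>i\<in>E j. c j i *\<^sub>R e i) (\<Union>j<N. I j) a"
    unfolding y_def [symmetric]
  proof (cases "N = 0")
    case False
    have finF: "finite (F j)" and F_ne: "F j \<noteq> {}" if "j - 1 < N" for j
      using finI[OF that] E(1,2) I_ne[OF that] by (auto simp: F_def)
    have "block_basis e N u F"
      unfolding block_basis_def
    proof (intro conjI ballI exI[of _ b])
      fix j assume j: "j \<in> {1..N}"
      then have j': "j - 1 < N" by auto
      show "finite (F j)" "F j \<noteq> {}" using finF F_ne j' by auto
      show "F j \<subseteq> {1..}" using E(3) by (force simp: F_def)
      show "u j = (\<Sum>k\<in>F j. b k *\<^sub>R e k)" using u_eq j' by simp
      show "u j \<noteq> 0" using u_norm[OF j'] npos[OF j'] by auto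
      fix k assume "k \<in> F j"
      then obtain i where i: "i \<in> I (j - 1)" "k \<in> E i" by (auto simp: F_def)
      then have "\<sigma> i \<noteq> 0" using I[OF j' i(1)] by (simp add: \<sigma>_def)
      then show "b k \<noteq> 0" using i c by (simp add: b_def \<iota>)
    next
      fix j assume j: "j \<in> {1..<N}"
      then have j': "j - 1 < N" "Suc j - 1 < N" by auto
      have "k < l" if kl: "k \<in> F j" "l \<in> F (Suc j)" for k l
      proof -
        obtain i i' where "i \<in> I (j - 1)" "k \<in> E i" "i' \<in> I j" "l \<in> E i'"
          using kl by (auto simp: F_def)
        moreover have "j - 1 < j" using j by auto
        ultimately show ?thesis using ordI[of "j - 1" j] j E(4) by (metis atLeastLessThan_iff)
      qed
      then show "Max (F j) < Min (F (Suc j))"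
        using finF[OF j'(1)] F_ne[OF j'(1)] finF[OF j'(2)] F_ne[OF j'(2)] by simp
    qed
    moreover have "N \<le> Min (F 1)"
    proof -
      have "N \<le> k" if "k \<in> F 1" for k
        using that I[of 0] False E(3) by (force simp: F_def)
      then show ?thesis using finF[of 1] F_ne[of 1] False by simp
    qed
    ultimately have "C * (\<Sum>j=1..N. norm (u j)) \<le> norm (\<Sum>j=1..N. u j)"
      using low [unfolded asymptotic_l1_bound_def, rule_format, of N u F] False by simp
    moreover have "(\<Sum>j=1..N. norm (u j)) = (\<Sum>j<N. sign_norm y (I j) a)"
      using u_norm by (simp add: sum.atLeast1_atMost_eq)
    moreover have "(\<Sum>j=1..N. u j) = sign_sum y (\<Union>j<N. I j) a T"
    proof -
      have "sign_sum y (\<Union>j<N. I j) a T = (\<Sum>j<N. sign_sum y (I j) a T)"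
        unfolding sign_sum_def using finI disjI by (intro sum.UNION_disjoint) auto
      then show ?thesis by (simp add: sum.atLeast1_atMost_eq u_def)
    qed
    ultimately show "C * (\<Sum>j<N. sign_norm y (I j) a) \<le> sign_norm y (\<Union>j<N. I j) a"
      using norm_sign_sum_le[of "\<Union>j<N. I j" y a T] finI by simp
  qed simp
qed

subsection \<open>Estimates on regular averages\<close>

lemma sum_charge_le_refinement:
  assumes \<pi>: "clopen_partition \<pi>" "clopen_partition \<pi>'" "refines UNIV \<pi>' \<pi>" and \<sigma>: "\<sigma> \<subseteq> \<pi>"
  shows "(\<Sum>U\<in>\<sigma>. \<bar>charge \<mu> U\<bar>) \<le> (\<Sum>V\<in>{V\<in>\<pi>'. \<exists>U\<in>\<sigma>. V \<subseteq> U}. \<bar>charge \<mu> V\<bar>)"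
proof -
  have fin: "finite \<sigma>" "finite \<pi>'" and ne: "\<And>V. V \<in> \<pi>' \<Longrightarrow> V \<noteq> {}"
    using \<pi> \<sigma> finite_subset by (auto simp: clopen_partition_def partition_on_def)
  have disj: "U = U'" if U: "U \<in> \<sigma>" "U' \<in> \<sigma>" "V \<in> \<pi>'" "V \<subseteq> U" "V \<subseteq> U'" for U U' V
  proof -
    obtain x where "x \<in> V" using ne[OF U(3)] by blast
    then show ?thesis
      using clopen_partition_cell[OF \<pi>(1), of x] U \<sigma> by (metis subsetD)
  qed
  have disj': "\<forall>U\<in>\<sigma>. \<forall>U'\<in>\<sigma>. U \<noteq> U' \<longrightarrow> {V\<in>\<pi>'. V \<subseteq> U} \<inter> {V\<in>\<pi>'. V \<subseteq> U'} = {}"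
    using disj by blast
  have "(\<Sum>U\<in>\<sigma>. \<bar>charge \<mu> U\<bar>) \<le> (\<Sum>U\<in>\<sigma>. \<Sum>V\<in>{V\<in>\<pi>'. V \<subseteq> U}. \<bar>charge \<mu> V\<bar>)"
    using \<sigma> by (intro sum_mono abs_charge_le_refinement[OF \<pi>]) auto
  also have "\<dots> = (\<Sum>V\<in>(\<Union>U\<in>\<sigma>. {V\<in>\<pi>'. V \<subseteq> U}). \<bar>charge \<mu> V\<bar>)"
    using fin by (intro sum.UNION_disjoint [symmetric] disj') auto
  also have "(\<Union>U\<in>\<sigma>. {V\<in>\<pi>'. V \<subseteq> U}) = {V\<in>\<pi>'. \<exists>U\<in>\<sigma>. V \<subseteq> U}" by auto
  finally show ?thesis .
qed

text \<open>The total variation of \<open>\<mu>\<close> on the union of the cells, as far as it is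
  visible at the resolution of these cells; refining clopen cells can only increase it.\<close>

definition variation :: "'k::topological_space C_dual \<Rightarrow> 'k set set \<Rightarrow> real"
  where "variation \<mu> \<sigma> = (\<Sum>V\<in>\<sigma>. \<bar>charge \<mu> V\<bar>)"

text \<open>Refinement cannot decrease the variation outside \<sigma>, so the gain inside \<sigma>
  is at most the total gain.\<close>

lemma variation_refined_part_le:
  assumes \<pi>: "clopen_partition \<pi>" "clopen_partition \<pi>'" "refines UNIV \<pi>' \<pi>" and \<sigma>: "\<sigma> \<subseteq> \<pi>"
  shows "variation \<mu> {V\<in>\<pi>'. \<exists>U\<in>\<sigma>. V \<subseteq> U} \<le> variation \<mu> \<sigma> + (variation \<mu> \<pi>' - variation \<mu> \<pi>)"
proof -
  let ?A = "{V\<in>\<pi>'. \<exists>U\<in>\<sigma>. V \<subseteq> U}" and ?B = "{V\<in>\<pi>'. \<exists>U\<in>\<pi> - \<sigma>. V \<subseteq> U}"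
  have fin: "finite \<pi>" "finite \<pi>'" and ne: "\<And>V. V \<in> \<pi>' \<Longrightarrow> V \<noteq> {}"
    using \<pi> by (auto simp: clopen_partition_def partition_on_def)
  have "?A \<inter> ?B = {}"
  proof (rule ccontr)
    assume "?A \<inter> ?B \<noteq> {}"
    then obtain V U U' where V: "V \<in> \<pi>'" "U \<in> \<sigma>" "V \<subseteq> U" "U' \<in> \<pi> - \<sigma>" "V \<subseteq> U'" by blast
    obtain x where "x \<in> V" using ne[OF V(1)] by blast
    then have "U = U'"
      using clopen_partition_cell[OF \<pi>(1), of x] V \<sigma> by (metis DiffD1 subsetD)
    then show False using V by blast
  qed
  then have "variation \<mu> ?A + variation \<mu> ?B = variation \<mu> (?A \<union> ?B)"
    unfolding variation_def using fin by (intro sum.union_disjoint [symmetric]) auto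
  also have "\<dots> \<le> variation \<mu> \<pi>'"
    unfolding variation_def using fin by (intro sum_mono2) auto
  finally have 1: "variation \<mu> ?A + variation \<mu> ?B \<le> variation \<mu> \<pi>'" .
  have "variation \<mu> (\<pi> - \<sigma>) \<le> variation \<mu> ?B"
    unfolding variation_def using sum_charge_le_refinement[OF \<pi>, of "\<pi> - \<sigma>"] by blast
  moreover have "variation \<mu> (\<pi> - \<sigma>) = variation \<mu> \<pi> - variation \<mu> \<sigma>"
    unfolding variation_def using fin \<sigma> by (simp add: sum_diff)
  ultimately show ?thesis using 1 by linarith
qed

text \<open>Choose the signs of the values at \<open>x\<close> and evaluate at
  \<open>x\<close>.\<close>

lemma sum_abs_le_sign_norm:
  fixes y :: "nat \<Rightarrow> 'k::topological_space C"
  assumes "finite H"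
  shows "(\<Sum>i\<in>H. a i * \<bar>y i x\<bar>) \<le> sign_norm y H a"
proof -
  let ?f = "sign_sum y H a {i. 0 \<le> y i x}"
  have "?f x = (\<Sum>i\<in>H. a i * \<bar>y i x\<bar>)"
    unfolding sign_sum_def apply_bcontfun_sum by (intro sum.cong) auto
  then have "(\<Sum>i\<in>H. a i * \<bar>y i x\<bar>) \<le> norm ?f" using norm_bounded[of ?f x] by simp
  then show ?thesis using norm_sign_sum_le[OF assms] order_trans by blast
qed

locale block_partition_sequence =
  fixes y :: "nat \<Rightarrow> 'k::topological_space C" and \<pi> :: "nat \<Rightarrow> 'k set set" and t :: "nat \<Rightarrow> real"
  assumes norm_y: "norm (y i) = 1"
    and clopen: "clopen_partition (\<pi> i)"
    and refined: "i \<le> j \<Longrightarrow> refines UNIV (\<pi> j) (\<pi> i)"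
    and osc: "oscillation_le (\<pi> i) (y i) (t i)"
    and t_nonneg: "0 \<le> t i"
begin

abbreviation large :: "nat \<Rightarrow> 'k set set"
  where "large i \<equiv> large_cells (\<pi> i) (y i) (t i)"

lemma large_subset: "large i \<subseteq> \<pi> i"
  by (auto simp: large_cells_def)

text \<open>On the finest partition involved the signed sum is almost constant on cells, and on a
  cell \<open>V\<close> it is controlled by regularity on the indices whose large cells cover
  \<open>V\<close>. Integrating with Jensen and exchanging the sums leaves the masses of the large
  sets, each at most \<eta>. One \<tau> pays for the oscillation, the other for values below the
  thresholds.\<close>

lemma abs_apply_sign_sum_le:
  assumes reg: "regular_average y g I a p" and g: "0 < g" "g < 1" and J: "J \<subseteq> I"
    and \<mu>: "norm \<mu> \<le> 1" and \<tau>: "sum t I \<le> \<tau>"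
    and v: "\<And>i l. i \<in> J \<Longrightarrow> l \<in> J \<Longrightarrow> i \<le> l \<Longrightarrow>
      variation \<mu> (large i) + (variation \<mu> (\<pi> l) - variation \<mu> (\<pi> i)) \<le> \<eta>"
    and \<eta>: "0 \<le> \<eta>"
  shows "\<bar>blinfun_apply \<mu> (sign_sum y J a S)\<bar> \<le> 2 * \<tau> + (\<eta> * sum p J) powr g"
proof -
  have finI: "finite I" and pos: "\<And>i. i \<in> I \<Longrightarrow> 0 < a i \<and> 0 \<le> p i" and p1: "sum p I = 1"
    and le: "\<And>H. H \<subseteq> I \<Longrightarrow> sign_norm y H a \<le> sum p H powr g"
    using reg by (auto simp: regular_average_def)
  have finJ: "finite J" using finI J finite_subset by blast
  have p_le1: "sum p H \<le> 1" if "H \<subseteq> I" for H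
    using sum_mono2[OF finI that, of p] pos p1 by auto
  have p_nn: "0 \<le> sum p H" if "H \<subseteq> I" for H
    using pos that by (intro sum_nonneg) auto
  \<comment> \<open>Regularity on singletons bounds the coefficients, so weighted thresholds sum to
    at most \<tau>.\<close>
  have a_le1: "a i \<le> 1" if i: "i \<in> I" for i
  proof -
    have "a i = sign_norm y {i} a" using pos[OF i] by (simp add: norm_y)
    also have "\<dots> \<le> sum p {i} powr g" using i by (intro le) auto
    also have "\<dots> \<le> 1" using p_le1[of "{i}"] p_nn[of "{i}"] i g by (intro powr_le1) auto
    finally show ?thesis .
  qed
  have at_le: "(\<Sum>i\<in>H. a i * t i) \<le> \<tau>" if "H \<subseteq> I" for H
  proof -
    have "(\<Sum>i\<in>H. a i * t i) \<le> sum t H"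
      using a_le1 t_nonneg that by (intro sum_mono) (simp add: mult_left_le_one_le mult_right_le_one_le subset_iff pos less_imp_le)
    also have "\<dots> \<le> sum t I" using finI that t_nonneg by (intro sum_mono2) auto
    finally show ?thesis using \<tau> by simp
  qed
  show ?thesis
  proof (cases "J = {}")
    case True
    have "0 \<le> \<tau>" using at_le[of "{}"] by simp
    then show ?thesis using True by (simp add: sign_sum_def)
  next
    case False
    define l where "l = Max J"
    have l: "l \<in> J" "\<And>i. i \<in> J \<Longrightarrow> i \<le> l" using False finJ by (auto simp: l_def)
    have fin: "finite (\<pi> l)" and ne: "\<And>V. V \<in> \<pi> l \<Longrightarrow> V \<noteq> {}"
      using clopen[of l] by (auto simp: clopen_partition_def partition_on_def)
    define q where "q V = (SOME x. x \<in> V)" for V :: "'k set"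
    have q: "q V \<in> V" if "V \<in> \<pi> l" for V
      using ne[OF that] unfolding q_def by (simp add: some_in_eq)
    define f where "f = sign_sum y J a S"
    have cell: "\<exists>U\<in>\<pi> i. V \<subseteq> U" if "V \<in> \<pi> l" "i \<in> J" for V i
      using refined[OF l(2)[OF that(2)]] that(1) by (auto simp: refines_def)
    have osc_f: "\<bar>f x - f (q V)\<bar> \<le> \<tau>" if V: "V \<in> \<pi> l" "x \<in> V" for V x
    proof -
      have "f x - f (q V) = (\<Sum>i\<in>J. (if i \<in> S then a i else - a i) * (y i x - y i (q V)))"
        by (simp add: f_def sign_sum_def apply_bcontfun_sum sum_subtractf right_diff_distrib)
      also have "\<bar>\<dots>\<bar> \<le> (\<Sum>i\<in>J. \<bar>(if i \<in> S then a i else - a i) * (y i x - y i (q V))\<bar>)"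
        by (rule sum_abs)
      also have "\<dots> \<le> (\<Sum>i\<in>J. a i * t i)"
      proof (rule sum_mono)
        fix i assume i: "i \<in> J"
        obtain U where "U \<in> \<pi> i" "V \<subseteq> U" using cell[OF V(1) i] by blast
        then have "\<bar>y i x - y i (q V)\<bar> \<le> t i"
          using osc[of i] V q[OF V(1)] unfolding oscillation_le_def by blast
        moreover have "0 < a i" using pos i J by blast
        ultimately show "\<bar>(if i \<in> S then a i else - a i) * (y i x - y i (q V))\<bar> \<le> a i * t i"
          by (simp add: abs_mult)
      qed
      also have "\<dots> \<le> \<tau>" using at_le[OF J] .
      finally show ?thesis .
    qed
    \<comment> \<open>For indices of \<open>J\<close> outside \<open>H V\<close> the value at the
      sample point \<open>q V\<close> is below the threshold \<open>t i\<close>.\<close>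
    define H where "H V = {i\<in>J. \<exists>U\<in>large i. V \<subseteq> U}" for V
    have H: "H V \<subseteq> J" "H V \<subseteq> I" "finite (H V)" for V
      using J finJ by (auto simp: H_def)
    have f_le: "\<bar>f (q V)\<bar> \<le> sum p (H V) powr g + \<tau>" if V: "V \<in> \<pi> l" for V
    proof -
      have "\<bar>f (q V)\<bar> = \<bar>\<Sum>i\<in>J. (if i \<in> S then a i else - a i) * y i (q V)\<bar>"
        by (simp add: f_def sign_sum_def apply_bcontfun_sum)
      also have "\<dots> \<le> (\<Sum>i\<in>J. \<bar>(if i \<in> S then a i else - a i) * y i (q V)\<bar>)"
        by (rule sum_abs)
      also have "\<dots> = (\<Sum>i\<in>J. a i * \<bar>y i (q V)\<bar>)"
        using pos J by (intro sum.cong) (auto simp: abs_mult subset_iff less_imp_le)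
      also have "\<dots> = (\<Sum>i\<in>H V. a i * \<bar>y i (q V)\<bar>) + (\<Sum>i\<in>J - H V. a i * \<bar>y i (q V)\<bar>)"
        using sum.subset_diff[OF H(1) finJ] by (simp add: add.commute)
      also have "(\<Sum>i\<in>J - H V. a i * \<bar>y i (q V)\<bar>) \<le> (\<Sum>i\<in>J - H V. a i * t i)"
      proof (rule sum_mono)
        fix i assume i: "i \<in> J - H V"
        obtain U where U: "U \<in> \<pi> i" "V \<subseteq> U" using cell[OF V] i by blast
        have "\<not> t i < \<bar>y i (q V)\<bar>"
        proof
          assume "t i < \<bar>y i (q V)\<bar>"
          then have "U \<in> large i" using U q[OF V] by (auto simp: large_cells_def)
          then show False using i U by (auto simp: H_def)
        qed
        moreover have "0 < a i" using pos i J by blast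
        ultimately show "a i * \<bar>y i (q V)\<bar> \<le> a i * t i" by simp
      qed
      also have "(\<Sum>i\<in>J - H V. a i * t i) \<le> \<tau>" using J by (intro at_le) auto
      also have "(\<Sum>i\<in>H V. a i * \<bar>y i (q V)\<bar>) \<le> sum p (H V) powr g"
        using sum_abs_le_sign_norm[OF H(3), where a = a and y = y and x = "q V"] le[OF H(2)]
        by (rule order_trans)
      finally show ?thesis by simp
    qed
    have "0 \<le> \<tau>" using at_le[of "{}"] by simp
    have var1: "(\<Sum>V\<in>\<pi> l. \<bar>charge \<mu> V\<bar>) \<le> 1"
      using sum_charge_le_norm[OF clopen subset_refl, of \<mu> l] \<mu> by simp
    have "\<bar>blinfun_apply \<mu> f\<bar> \<le> norm \<mu> * \<tau> + (\<Sum>V\<in>\<pi> l. \<bar>charge \<mu> V\<bar> * \<bar>f (q V)\<bar>)"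
      using abs_apply_le_charge[OF clopen osc_f] .
    also have "norm \<mu> * \<tau> \<le> \<tau>" using \<mu> \<open>0 \<le> \<tau>\<close> by (simp add: mult_left_le_one_le)
    also have "(\<Sum>V\<in>\<pi> l. \<bar>charge \<mu> V\<bar> * \<bar>f (q V)\<bar>)
        \<le> (\<Sum>V\<in>\<pi> l. \<bar>charge \<mu> V\<bar> * (sum p (H V) powr g + \<tau>))"
      using f_le by (intro sum_mono mult_left_mono) auto
    also have "\<dots> = (\<Sum>V\<in>\<pi> l. \<bar>charge \<mu> V\<bar> * sum p (H V) powr g) + (\<Sum>V\<in>\<pi> l. \<bar>charge \<mu> V\<bar>) * \<tau>"
      by (simp add: distrib_left sum.distrib sum_distrib_right)
    also have "(\<Sum>V\<in>\<pi> l. \<bar>charge \<mu> V\<bar>) * \<tau> \<le> \<tau>"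
      using var1 \<open>0 \<le> \<tau>\<close> by (intro mult_left_le_one_le) (auto intro: sum_nonneg)
    also have "(\<Sum>V\<in>\<pi> l. \<bar>charge \<mu> V\<bar> * sum p (H V) powr g) \<le>
        (\<Sum>V\<in>\<pi> l. \<bar>charge \<mu> V\<bar> * sum p (H V)) powr g"
      using fin var1 g p_nn[OF H(2)] by (intro sum_mult_powr_le) auto
    also have "\<dots> \<le> (\<eta> * sum p J) powr g"
    proof (rule powr_mono2)
      \<comment> \<open>Exchange of summation: the mean of \<open>sum p (H V)\<close> over cells is
        the mean over \<open>i\<close> of the mass that the finest partition sees in the large set
        of \<open>i\<close>.\<close>
      have "(\<Sum>V\<in>\<pi> l. \<bar>charge \<mu> V\<bar> * sum p (H V))
          = (\<Sum>V\<in>\<pi> l. \<Sum>i\<in>J. if \<exists>U\<in>large i. V \<subseteq> U then \<bar>charge \<mu> V\<bar> * p i else 0)"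
        unfolding H_def sum_distrib_left using finJ by (simp add: sum.inter_filter)
      also have "\<dots> = (\<Sum>i\<in>J. \<Sum>V\<in>\<pi> l. if \<exists>U\<in>large i. V \<subseteq> U then \<bar>charge \<mu> V\<bar> * p i else 0)"
        by (rule sum.swap)
      also have "\<dots> = (\<Sum>i\<in>J. variation \<mu> {V\<in>\<pi> l. \<exists>U\<in>large i. V \<subseteq> U} * p i)"
        unfolding variation_def sum_distrib_right using fin by (simp add: sum.inter_filter)
      also have "\<dots> \<le> (\<Sum>i\<in>J. \<eta> * p i)"
      proof (intro sum_mono mult_right_mono)
        fix i assume i: "i \<in> J"
        show "variation \<mu> {V\<in>\<pi> l. \<exists>U\<in>large i. V \<subseteq> U} \<le> \<eta>"
          using variation_refined_part_le[OF clopen clopen refined[OF l(2)[OF i]] large_subset, of \<mu>]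
            v[OF i l(1) l(2)[OF i]] by linarith
        show "0 \<le> p i" using pos i J by blast
      qed
      finally show "(\<Sum>V\<in>\<pi> l. \<bar>charge \<mu> V\<bar> * sum p (H V)) \<le> \<eta> * sum p J"
        by (simp add: sum_distrib_left)
    qed (use g p_nn[OF H(2)] in \<open>auto intro!: sum_nonneg\<close>)
    finally show ?thesis by (simp add: f_def)
  qed
qed

text \<open>The variation over \<open>\<pi> i\<close> increases with \<open>i\<close> and stays below \<open>1\<close>. Cutting the indices into
  \<open>n + 1\<close> groups on which it changes by at most \<open>1 / n\<close> keeps the mass near the small sets
  under control although later partitions may reveal more mass.\<close>

lemma abs_apply_regular_average_le:
  assumes reg: "regular_average y g I a p" and g: "0 < g" "g < 1"
    and \<mu>: "norm \<mu> \<le> 1" and \<tau>: "sum t I \<le> \<tau>" and n: "0 < n"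
    and bad: "sum p {i\<in>I. 3 / n \<le> variation \<mu> (large i)} \<le> \<delta>"
  shows "\<bar>blinfun_apply \<mu> (sign_sum y I a S)\<bar> \<le>
    \<delta> powr g + real (n + 1) * (2 * \<tau>) + real (n + 1) * (4 / (real n * real (n + 1))) powr g"
proof -
  have finI: "finite I" and pos: "\<And>i. i \<in> I \<Longrightarrow> 0 < a i \<and> 0 \<le> p i" and p1: "sum p I = 1"
    and le: "\<And>H. H \<subseteq> I \<Longrightarrow> sign_norm y H a \<le> sum p H powr g"
    using reg by (auto simp: regular_average_def)
  have p_nn: "0 \<le> sum p H" if "H \<subseteq> I" for H
    using pos that by (intro sum_nonneg) auto
  define B where "B = {i\<in>I. 3 / n \<le> variation \<mu> (large i)}"
  \<comment> \<open>The variation lies between 0 and 1, so the level takes only the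
    \<open>n + 1\<close> values from 0 to \<open>n\<close>.\<close>
  define lev where "lev i = nat \<lfloor>n * variation \<mu> (\<pi> i)\<rfloor>" for i
  define J where "J k = {i\<in>I - B. lev i = k}" for k
  have var: "0 \<le> variation \<mu> (\<pi> i)" "variation \<mu> (\<pi> i) \<le> 1" for i
    using sum_charge_le_norm[OF clopen subset_refl, of \<mu> i] \<mu>
    by (auto simp: variation_def intro!: sum_nonneg)
  have lev_le: "lev i \<le> n" for i
    using var[of i] n unfolding lev_def by (simp add: nat_le_iff floor_le_iff mult_left_le)
      (smt (verit) mult_left_le of_nat_0_le_iff)
  have J_Un: "I - B = (\<Union>k\<in>{..n}. J k)" using lev_le by (auto simp: J_def)
  have J_fin: "finite (J k)" for k using finI by (simp add: J_def)
  have split: "sum h (I - B) = (\<Sum>k\<le>n. sum h (J k))" for h :: "nat \<Rightarrow> 'b::comm_monoid_add"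
    unfolding J_Un using J_fin by (intro sum.UNION_disjoint) (auto simp: J_def)
  have BI: "B \<subseteq> I" by (auto simp: B_def)
  have "sign_sum y I a S = sign_sum y (I - B) a S + sign_sum y B a S"
    unfolding sign_sum_def by (rule sum.subset_diff[OF BI finI])
  also have "sign_sum y (I - B) a S = (\<Sum>k\<le>n. sign_sum y (J k) a S)"
    unfolding sign_sum_def by (rule split)
  finally have "\<bar>blinfun_apply \<mu> (sign_sum y I a S)\<bar> \<le>
      \<bar>\<Sum>k\<le>n. blinfun_apply \<mu> (sign_sum y (J k) a S)\<bar> + \<bar>blinfun_apply \<mu> (sign_sum y B a S)\<bar>"
    by (simp add: blinfun.add_right blinfun.sum_right)
  also have "\<bar>\<Sum>k\<le>n. blinfun_apply \<mu> (sign_sum y (J k) a S)\<bar> \<le>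
      (\<Sum>k\<le>n. \<bar>blinfun_apply \<mu> (sign_sum y (J k) a S)\<bar>)" by (rule sum_abs)
  \<comment> \<open>Within a level the variation changes by less than \<open>1 / n\<close>, and
    outside \<open>B\<close> the large sets have mass below \<open>3 / n\<close>; together these
    give \<open>4 / n\<close>.\<close>
  also have "\<dots> \<le> (\<Sum>k\<le>n. 2 * \<tau> + (4 / n * sum p (J k)) powr g)"
  proof (rule sum_mono)
    fix k
    show "\<bar>blinfun_apply \<mu> (sign_sum y (J k) a S)\<bar> \<le> 2 * \<tau> + (4 / n * sum p (J k)) powr g"
    proof (rule abs_apply_sign_sum_le[OF reg g _ \<mu> \<tau>])
      fix i l assume "i \<in> J k" "l \<in> J k"
      then have "nat \<lfloor>n * variation \<mu> (\<pi> i)\<rfloor> = nat \<lfloor>n * variation \<mu> (\<pi> l)\<rfloor>"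
        and i: "variation \<mu> (large i) < 3 / n"
        by (auto simp: J_def lev_def B_def)
      then have "\<lfloor>n * variation \<mu> (\<pi> i)\<rfloor> = \<lfloor>n * variation \<mu> (\<pi> l)\<rfloor>"
        using var[of i] var[of l] by (simp add: nat_eq_iff)
      then have "n * variation \<mu> (\<pi> l) - n * variation \<mu> (\<pi> i) < 1" by linarith
      then have "variation \<mu> (\<pi> l) - variation \<mu> (\<pi> i) < 1 / n" using n by (simp add: field_simps)
      then show "variation \<mu> (large i) + (variation \<mu> (\<pi> l) - variation \<mu> (\<pi> i)) \<le> 4 / n"
        using i by (simp add: field_simps)
    qed (auto simp: J_def)
  qed
  \<comment> \<open>The factor \<open>n + 1\<close> is pulled out to create weights
    \<open>1 / (n + 1)\<close> for Jensen, which gains over bounding each level separately.\<close>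
  also have "\<dots> = real (n + 1) * (2 * \<tau>) + real (n + 1) * (\<Sum>k\<le>n. (1 / real (n + 1)) * (4 / n * sum p (J k)) powr g)"
    unfolding sum.distrib sum_distrib_left [symmetric] by simp
  also have "(\<Sum>k\<le>n. (1 / real (n + 1)) * (4 / n * sum p (J k)) powr g) \<le>
      (\<Sum>k\<le>n. (1 / real (n + 1)) * (4 / n * sum p (J k))) powr g"
    using g by (intro sum_mult_powr_le) (auto intro!: mult_nonneg_nonneg divide_nonneg_nonneg p_nn simp: J_def)
  also have "\<dots> \<le> (4 / (real n * real (n + 1))) powr g"
  proof (rule powr_mono2)
    have "(\<Sum>k\<le>n. sum p (J k)) \<le> 1"
      using sum_mono2[OF finI, of "I - B" p] pos p1 by (auto simp: split)
    then have "4 / (real n * real (n + 1)) * (\<Sum>k\<le>n. sum p (J k)) \<le> 4 / (real n * real (n + 1)) * 1"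
      by (intro mult_left_mono) auto
    moreover have "(\<Sum>k\<le>n. (1 / real (n + 1)) * (4 / n * s k)) = 4 / (real n * real (n + 1)) * sum s {..n}" for s
      unfolding sum_distrib_left by (intro sum.cong) (auto simp: field_simps)
    ultimately show "(\<Sum>k\<le>n. (1 / real (n + 1)) * (4 / n * sum p (J k))) \<le> 4 / (real n * real (n + 1))"
      by simp
  qed (use g in \<open>auto intro!: sum_nonneg mult_nonneg_nonneg divide_nonneg_nonneg p_nn simp: J_def\<close>)
  \<comment> \<open>On the bad indices the norm of the signed sum is already small, by regularity
    and the hypothesis on \<open>p\<close>.\<close>
  also have "\<bar>blinfun_apply \<mu> (sign_sum y B a S)\<bar> \<le> \<delta> powr g"
  proof -
    have "\<bar>blinfun_apply \<mu> (sign_sum y B a S)\<bar> \<le> norm \<mu> * norm (sign_sum y B a S)"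
      using norm_blinfun[of \<mu> "sign_sum y B a S"] by simp
    also have "\<dots> \<le> 1 * norm (sign_sum y B a S)" using \<mu> by (intro mult_right_mono) auto
    also have "\<dots> \<le> sign_norm y B a" using norm_sign_sum_le finite_subset[OF BI finI] by simp
    also have "\<dots> \<le> sum p B powr g" by (rule le[OF BI])
    also have "\<dots> \<le> \<delta> powr g" using bad g p_nn[OF BI] by (intro powr_mono2) (auto simp: B_def)
    finally show ?thesis .
  qed
  finally show ?thesis using n by (simp add: mult_left_mono add.commute add.left_commute)
qed

end

section \<open>Weak-star compactness and the contradiction\<close>

text \<open>Charges are evaluations at fixed continuous functions, hence weak-star continuous, and
  so are finite sums of their absolute values.\<close>

lemma closedin_variation:
  assumes "finite \<sigma>"
  shows "closedin weak_star_topology {\<mu>. r \<le> variation \<mu> \<sigma>}"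
proof -
  have "continuous_map weak_star_topology euclideanreal (\<lambda>\<mu>. charge \<mu> V)" for V :: "'a set"
    unfolding charge_def by (rule strong_operator_topology_continuous_evaluation)
  then have "continuous_map weak_star_topology euclideanreal (\<lambda>\<mu>. variation \<mu> \<sigma>)"
    unfolding variation_def using assms by (intro continuous_map_sum continuous_map_real_abs) auto
  then have "closedin weak_star_topology {\<mu> \<in> topspace weak_star_topology. variation \<mu> \<sigma> \<in> {r..}}"
    by (rule closedin_continuous_map_preimage) simp
  then show ?thesis by (simp add: strong_operator_topology_topspace)
qed

lemma compactin_common_point:
  assumes M: "compactin X M" and cl: "\<And>j. j \<in> J \<Longrightarrow> closedin X (A j)"
    and fip: "\<And>F. finite F \<Longrightarrow> F \<subseteq> J \<Longrightarrow> \<exists>x\<in>M. \<forall>j\<in>F. x \<in> A j"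
  shows "\<exists>x\<in>M. \<forall>j\<in>J. x \<in> A j"
proof -
  have "M \<inter> \<Inter>(A ` J) \<noteq> {}"
  proof (rule compactin_fip[THEN iffD1, OF M, THEN conjunct2, rule_format], intro conjI ballI allI impI)
    show "closedin X C" if "C \<in> A ` J" for C using that cl by blast
    fix \<F> assume "finite \<F> \<and> \<F> \<subseteq> A ` J"
    then obtain F where F: "finite F" "F \<subseteq> J" "\<F> = A ` F" by (metis finite_subset_image)
    then show "M \<inter> \<Inter>\<F> \<noteq> {}" using fip[OF F(1,2)] by blast
  qed
  then show ?thesis by blast
qed

theorem corollary5p4:
  fixes X :: "'k::topological_space C set"
    and e :: "nat \<Rightarrow> 'k C"
    and M :: "'k C_dual set"
  assumes "compact_space (euclidean :: 'k topology)"
    and "metrizable_space (euclidean :: 'k topology)"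
    and "banach_subspace X"
    and "schauder_basis e X" and "normalized e"
    and "asymptotic_l1 e"
    and "totally_disconnected_space (euclidean :: 'k topology)"
    and "M \<subseteq> cball 0 1"
    and "compactin weak_star_topology M"
    and "norms M X"
  shows "\<not> separable_space (top_of_set M)"
proof
  assume sep: "separable_space (top_of_set M)"
  have K: "compact_space (euclidean :: 'k topology)" "Hausdorff_space (euclidean :: 'k topology)"
    "totally_disconnected_space (euclidean :: 'k topology)"
    using assms metrizable_imp_Hausdorff_space by auto
  have norm_e: "norm (e n) = 1" and e_X: "e n \<in> X" if "1 \<le> n" for n
    using assms(4,5) that by (auto simp: normalized_def schauder_basis_def)
  have sub_X: "subspace X" using assms(3) by (simp add: banach_subspace_def)
  obtain C where C: "0 < C" "asymptotic_l1_bound C e"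
    using assms(6) unfolding asymptotic_l1_def asymptotic_l1_bound_def by blast
  obtain \<rho> where \<rho>: "0 < \<rho>" and norming: "\<And>f. f \<in> X \<Longrightarrow> \<exists>\<mu>\<in>M. \<rho> * norm f \<le> \<bar>blinfun_apply \<mu> f\<bar>"
    using assms(10) unfolding norms_def by blast
  have M1: "norm \<mu> \<le> 1" if "\<mu> \<in> M" for \<mu> using assms(8) that by auto
  obtain D where D: "countable D" "D \<subseteq> M" "top_of_set M closure_of D = M"
    using sep by (auto simp: separable_space_def)
  have M_ne: "M \<noteq> {}" using norming[OF e_X[of 1]] by auto
  then have D_ne: "D \<noteq> {}" using D by auto
  define d where "d = from_nat_into D"
  have d: "d k \<in> M" for k using from_nat_into[OF D_ne] D(2) by (auto simp: d_def)
  have dense: "\<exists>k. norm (\<mu> - d k) < r" if "\<mu> \<in> M" "0 < r" for \<mu> r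
  proof -
    have "M \<inter> closure D = M"
      using D(2,3) by (simp add: closure_of_subtopology Int_absorb1)
    then have "\<mu> \<in> closure D" using that by blast
    then obtain \<nu> where \<nu>: "\<nu> \<in> D" "dist \<nu> \<mu> < r"
      using \<open>0 < r\<close> closure_approachable by blast
    obtain k where "\<nu> = d k"
      using from_nat_into_surj[OF D(1) \<nu>(1)] by (metis d_def)
    then show ?thesis using \<nu>(2) by (auto simp: dist_norm norm_minus_commute)
  qed
  \<comment> \<open>These are the error terms for \<tau> equal to \<open>1 / n ^ 2\<close> and
    exponent 3/4. The second is of order \<open>n\<close> to the power -1/2; it vanishes because the
    exponent exceeds 1/2.\<close>
  have "((\<lambda>n. real (n + 1) * (2 * (1 / n ^ 2)) +
      real (n + 1) * (4 / (real n * real (n + 1))) powr (3 / 4)) \<longlongrightarrow> 0) sequentially"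
    by real_asymp
  then have "eventually (\<lambda>n. real (n + 1) * (2 * (1 / n ^ 2)) +
      real (n + 1) * (4 / (real n * real (n + 1))) powr (3 / 4) < \<rho> / 2) sequentially"
    by (rule order_tendstoD) (use \<rho> in simp)
  then obtain n :: nat where n: "1 \<le> n" "real (n + 1) * (2 * (1 / n ^ 2)) +
      real (n + 1) * (4 / (real n * real (n + 1))) powr (3 / 4) < \<rho> / 2"
    using eventually_happens'[OF _ eventually_conj[OF eventually_ge_at_top[of 1]]]
    by (metis (no_types, lifting) sequentially_bot)
  \<comment> \<open>Geometric thresholds with total \<open>1 / n ^ 2\<close>, the \<tau> used in the
    choice of \<open>n\<close>.\<close>
  define t :: "nat \<Rightarrow> real" where "t j = (1 / n ^ 2) * (1 / 2) ^ Suc j" for j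
  have t: "0 < t j" for j using n by (simp add: t_def)
  have t_sum: "sum t I \<le> 1 / n ^ 2" if "finite I" for I
  proof -
    have "t sums ((1 / n ^ 2) * 1)" unfolding t_def by (intro sums_mult power_half_series)
    then show ?thesis
      using sum_le_suminf[OF sums_summable that, of t] t sums_unique by (fastforce intro: less_imp_le)
  qed
  have \<epsilon>: "0 < 1 / real n" using n by simp
  obtain E c \<pi> where E: "\<And>j. finite (E j)" "\<And>j. E j \<noteq> {}" "\<And>j. E j \<subseteq> {j<..}"
    "\<And>j k i l. j < k \<Longrightarrow> i \<in> E j \<Longrightarrow> l \<in> E k \<Longrightarrow> i < l" "\<And>j i. i \<in> E j \<Longrightarrow> c j i \<noteq> 0"
    "\<And>j. norm (\<Sum>i\<in>E j. c j i *\<^sub>R e i) = 1" "\<And>j. clopen_partition (\<pi> j)"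
    "\<And>j k. j \<le> k \<Longrightarrow> refines UNIV (\<pi> k) (\<pi> j)"
    "\<And>j. oscillation_le (\<pi> j) (\<Sum>i\<in>E j. c j i *\<^sub>R e i) (t j)"
    "\<And>j k. k \<le> j \<Longrightarrow> (\<Sum>V\<in>large_cells (\<pi> j) (\<Sum>i\<in>E j. c j i *\<^sub>R e i) (t j). \<bar>charge (d k) V\<bar>) \<le> 1 / n"
    by (rule small_block_sequence[OF K norm_e C(2,1) M1[OF d] \<epsilon> t], assumption, rule that)
  define y where "y j = (\<Sum>i\<in>E j. c j i *\<^sub>R e i)" for j
  interpret block_partition_sequence y \<pi> t
    by unfold_locales (use E t in \<open>auto simp: y_def less_imp_le\<close>)
  have y_X: "y j \<in> X" for j
    unfolding y_def using E(3)[of j] by (intro subspace_sum subspace_scale sub_X e_X) force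
  have fin_large: "finite (large j)" for j
    using finite_subset[OF large_subset] clopen by (auto simp: clopen_partition_def)
  \<comment> \<open>The large sets carry at most \<open>1 / n\<close> of \<open>d k\<close> from
    stage \<open>k\<close> on, and passing to \<open>\<mu>\<close> costs less than
    \<open>1 / n\<close>; this stays below \<open>3 / n\<close>.\<close>
  have eventually_small: "\<exists>k. \<forall>j\<ge>k. variation \<mu> (large j) < 3 / n" if \<mu>: "\<mu> \<in> M" for \<mu>
  proof -
    obtain k where k: "norm (\<mu> - d k) < 1 / n" using dense[OF \<mu> \<epsilon>] by blast
    have "variation \<mu> (large j) < 3 / n" if "k \<le> j" for j
    proof -
      have "variation \<mu> (large j) \<le> variation (d k) (large j) + norm (\<mu> - d k)"
        unfolding variation_def by (rule sum_charge_perturb[OF clopen large_subset])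
      moreover have "variation (d k) (large j) \<le> 1 / n"
        using E(10)[OF that] by (simp add: variation_def y_def)
      moreover have "3 / real n = 3 * (1 / real n)" by simp
      ultimately show ?thesis using k \<epsilon> by linarith
    qed
    then show ?thesis by blast
  qed
  define \<G> where "\<G> = {H. finite H \<and> (\<exists>\<mu>\<in>M. \<forall>i\<in>H. 3 / n \<le> variation \<mu> (large i))}"
  have hered: "B \<in> \<G>" if "A \<in> \<G>" "B \<subseteq> A" for A B
    using that finite_subset unfolding \<G>_def by blast
  \<comment> \<open>On an infinite branch compactness would yield a single \<open>\<mu>\<close> in
    \<open>M\<close> charging the large sets of all its indices, against
    \<open>eventually_small\<close>.\<close>
  have no_branch: "\<exists>A. finite A \<and> A \<subseteq> J \<and> A \<notin> \<G>" if J: "infinite J" for J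
  proof (rule ccontr)
    assume neg: "\<not> ?thesis"
    have "\<exists>\<mu>\<in>M. \<forall>j\<in>J. \<mu> \<in> {\<mu>. 3 / n \<le> variation \<mu> (large j)}"
    proof (rule compactin_common_point[OF assms(9) closedin_variation[OF fin_large]])
      fix F assume "finite F" "F \<subseteq> J"
      then have "F \<in> \<G>" using neg by blast
      then show "\<exists>\<mu>\<in>M. \<forall>j\<in>F. \<mu> \<in> {\<mu>. 3 / n \<le> variation \<mu> (large j)}"
        by (simp add: \<G>_def)
    qed
    then obtain \<mu> where \<mu>: "\<mu> \<in> M" "\<And>j. j \<in> J \<Longrightarrow> 3 / n \<le> variation \<mu> (large j)" by blast
    obtain k where k: "\<And>j. k \<le> j \<Longrightarrow> variation \<mu> (large j) < 3 / n"
      using eventually_small[OF \<mu>(1)] by blast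
    obtain j where "j \<in> J" "k \<le> j" using J unfolding infinite_nat_iff_unbounded_le by blast
    then show False using \<mu>(2) k by fastforce
  qed
  have "lower_l1 C y"
    unfolding y_def by (rule lower_l1_blocks[OF C(2) E(1-5)])
  \<comment> \<open>Every member of \<G> passes through the root, so \<open>{{}}\<close> demands
    smallness on all of \<G>.\<close>
  then have averages: "small_averages y \<G> {{}}"
    by (rule small_averages_well_founded[OF norm_y _ C(1) hered no_branch])
  \<comment> \<open>The contribution of the bad indices becomes \<open>\<rho> / 4\<close>, which
    together with the errors below \<open>\<rho> / 2\<close> stays under \<rho>.\<close>
  define \<delta> where "\<delta> = (\<rho> / 4) powr (4 / 3)"
  have \<delta>: "0 < \<delta>" "\<delta> powr (3 / 4) = \<rho> / 4" using \<rho> by (simp_all add: \<delta>_def powr_powr)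
  obtain I a p where reg: "regular_average y (3 / 4) I a p"
      and small: "\<And>H. H \<subseteq> I \<Longrightarrow> H \<in> \<G> \<Longrightarrow> sum p H \<le> \<delta>"
    using averages[unfolded small_averages_def, rule_format, of "3 / 4" \<delta> 0] \<delta>(1) by auto
  have finI: "finite I" and norm1: "sign_norm y I a = 1" using reg by (auto simp: regular_average_def)
  obtain S where S: "norm (sign_sum y I a S) = 1" using sign_norm_attained[OF finI] norm1 by metis
  have "sign_sum y I a S \<in> X"
    unfolding sign_sum_def by (intro subspace_sum subspace_scale sub_X y_X)
  then obtain \<mu> where \<mu>: "\<mu> \<in> M" "\<rho> \<le> \<bar>blinfun_apply \<mu> (sign_sum y I a S)\<bar>"
    using norming S by fastforce
  \<comment> \<open>The functional \<open>\<mu>\<close> itself witnesses that its bad indices form a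
    member of \<G>, on which \<open>p\<close> is small.\<close>
  have "{i\<in>I. 3 / n \<le> variation \<mu> (large i)} \<in> \<G>"
    using \<mu>(1) finI by (auto simp: \<G>_def)
  then have "\<bar>blinfun_apply \<mu> (sign_sum y I a S)\<bar> \<le> \<delta> powr (3 / 4) + real (n + 1) * (2 * (1 / n ^ 2)) +
      real (n + 1) * (4 / (real n * real (n + 1))) powr (3 / 4)"
    using small n(1) by (intro abs_apply_regular_average_le[OF reg] M1[OF \<mu>(1)] t_sum finI) auto
  then show False using \<mu>(2) n(2) \<delta>(2) \<rho> by linarith
qed

end
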